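(* For every partition $\lambda\vdash n+1$ we have $$\deg\frac{C_\lambda(\mathsf q)}{c^\lambda(\zeta_\lambda)c^\lambda(\zeta_\lambda^{-1})}=-2\ell(\mathsf w_{\lambda'})\quad\text{and}\quad\mathrm{sp}_0\bigg(\frac{\mathsf q^{2\ell(\mathsf w_{\lambda'})}C_\lambda(\mathsf q)}{c^\lambda(\zeta_\lambda)c^\lambda(\zeta_\lambda^{-1})}\bigg)=\prod_{\alpha\in\Phi_{G_\lambda}}(1-\zeta_\lambda^\alpha),$$ where $\mathrm{sp}_0$ denotes specialisation at $\mathsf q^{-1}=0$ and $\deg$ the degree in $\mathsf q$.
   Context: Fix $n\ge1$ and a partition $\lambda=(\lambda_1\ge\dots\ge\lambda_{r(\lambda)}>0)$ of $n+1$, with transpose $\lambda'$. $\mathsf w_{\lambda'}$ is the longest element of the Young subgroup $W_{\lambda'}\cong\mathfrak S_{\lambda_1'}\times\mathfrak S_{\lambda_2'}\times\cdots$ of $\mathfrak S_{n+1}$, so $\ell(\mathsf w_{\lambda'})=\frac12\sum_i\lambda_i'(\lambda_i'-1)=\sum_i(i-1)\lambda_i$. Let $P$ be the abelian group generated by $e_1,\dots,e_{n+1}$ subject to $e_1+\dots+e_{n+1}=0$, and $Q_\lambda\subseteq P$ the subgroup generated by the $e_i-e_j$ with $i,j$ in a common row of the tableau of shape $\lambda$ filled with $1,\dots,n+1$ row by row. $\mathbb Z[\zeta_\lambda]=\mathbb Z[P/Q_\lambda]$ is the group ring with basis $\zeta_\lambda^\gamma$ ($\gamma\in P/Q_\lambda$).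 For $1\le i\le r(\lambda)$ let $\tilde e_i=e_j+Q_\lambda$ for any $j$ in row $i$ and $z_i=\zeta_\lambda^{\tilde e_i}$ (so $z_1^{\lambda_1}\cdots z_{r(\lambda)}^{\lambda_{r(\lambda)}}=1$). $\Phi_{G_\lambda}=\{\tilde e_i-\tilde e_j:1\le i,j\le r(\lambda),\ i\ne j,\ \lambda_i=\lambda_j\}$. With $\mathsf q$ an indeterminate and $\mathsf v=-\mathsf q^{-1}$, $$C_\lambda(\mathsf q)=\mathsf q^{-n(n+1)}\prod_{i=1}^{r(\lambda)}\frac{\mathsf q^{\lambda_i^2-\lambda_i}(1-\mathsf q^{-2})^{\lambda_i}}{1-\mathsf q^{-2\lambda_i}},\qquad c^\lambda(\zeta_\lambda)=\prod_{\substack{1\le i<j\le r(\lambda)\\1\le k\le\lambda_j}}\frac{1-\mathsf v^{\lambda_i-\lambda_j+2k}z_i^{-1}z_j}{1-\mathsf v^{-\lambda_i-\lambda_j+2k}z_i^{-1}z_j},$$ and $c^\lambda(\zeta_\lambda^{-1})$ is obtained by replacing each $z_i$ by $z_i^{-1}$. The quotient $C_\lambda(\mathsf q)/(c^\lambda(\zeta_\lambda)c^\lambda(\zeta_\lambda^{-1}))$ is regarded as a Laurent series in $\mathsf q^{-1}$ with coefficients in $\mathbb Z[\zeta_\lambda]$ (expanding $(1-\mathsf v^mz_i^{\mp1}z_j^{\pm1})^{-1}$, $m>0$, as a geometric series); its degree is the largest exponent of $\mathsf q$ with non-zero coefficient. *)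

theory Defs
  imports
    "HOL-Algebra.Free_Abelian_Groups"
    "HOL-Algebra.Generated_Groups"
    "HOL-Algebra.Ring"
    "HOL-Combinatorics.Permutations"
begin

section \<open>Partitions and Young subgroups\<close>

text \<open>Partitions are lists of parts. Parts, and hence rows, are numbered from 0:
  \<open>lam ! i\<close> is the part that the mathematical text calls \<open>\<lambda>\<close> with index \<open>i + 1\<close>.\<close>

definition partition_of :: "nat \<Rightarrow> nat list \<Rightarrow> bool" where
  "partition_of N lam \<longleftrightarrow>
     sorted_wrt (\<ge>) lam \<and> (\<forall>x\<in>set lam. 0 < x) \<and> sum_list lam = N"

definition conj_partition :: "nat list \<Rightarrow> nat list" where
  "conj_partition lam = map (\<lambda>j. card {i. i < length lam \<and> j \<le> lam ! i}) [1..<Suc (hd lam)]"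

text \<open>The entries of row \<open>i\<close> when the diagram of \<open>mu\<close> is filled with \<open>1, 2, 3\<close> and so on, row by row.\<close>

definition row :: "nat list \<Rightarrow> nat \<Rightarrow> nat set" where
  "row mu i = {sum_list (take i mu) <.. sum_list (take (Suc i) mu)}"

definition young_subgroup :: "nat list \<Rightarrow> (nat \<Rightarrow> nat) set" where
  "young_subgroup mu =
     {w. w permutes {1..sum_list mu} \<and> (\<forall>i<length mu. w ` row mu i = row mu i)}"

text \<open>Coxeter length in the symmetric group on \<open>{1..N}\<close>: the least number of factors in an
  expression as a product of the simple transpositions \<open>(i, i + 1)\<close>.\<close>

definition perm_length :: "nat \<Rightarrow> (nat \<Rightarrow> nat) \<Rightarrow> nat" where
  "perm_length N w = (LEAST k. \<exists>ks. length ks = k \<and> set ks \<subseteq> {1..<N} \<and>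
      w = foldr (\<lambda>i u. Transposition.transpose i (Suc i) \<circ> u) ks id)"

definition longest_element :: "nat \<Rightarrow> (nat \<Rightarrow> nat) set \<Rightarrow> (nat \<Rightarrow> nat)" where
  "longest_element N W = (ARG_MAX (perm_length N) w. w \<in> W)"

definition length_w_conj :: "nat list \<Rightarrow> nat" where
  "length_w_conj lam = (let N = sum_list lam in
     perm_length N (longest_element N (young_subgroup (conj_partition lam))))"


section \<open>Group rings, Laurent series and total rings of fractions\<close>

definition group_ring :: "('g, 'm) monoid_scheme \<Rightarrow> ('g \<Rightarrow>\<^sub>0 int) ring" where
  "group_ring G =
    \<lparr> carrier = {f. Poly_Mapping.keys f \<subseteq> carrier G},
      monoid.mult = (\<lambda>f g. \<Sum>x\<in>Poly_Mapping.keys f. \<Sum>y\<in>Poly_Mapping.keys g.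
        Poly_Mapping.single (x \<otimes>\<^bsub>G\<^esub> y) (Poly_Mapping.lookup f x * Poly_Mapping.lookup g y)),
      one = Poly_Mapping.single \<one>\<^bsub>G\<^esub> 1,
      zero = 0,
      add = (+) \<rparr>"

text \<open>Laurent series in the inverse of the indeterminate \<open>q\<close>: \<open>F k\<close> is the coefficient of the
  \<open>k\<close>-th power of \<open>q\<close>, and the exponents that occur are bounded above.\<close>

definition laurent_ring :: "('a, 'm) ring_scheme \<Rightarrow> (int \<Rightarrow> 'a) ring" where
  "laurent_ring R =
    \<lparr> carrier = {F. (\<forall>k. F k \<in> carrier R) \<and> (\<exists>d. \<forall>k>d. F k = \<zero>\<^bsub>R\<^esub>)},
      monoid.mult = (\<lambda>F G k.
        \<Oplus>\<^bsub>R\<^esub>i\<in>{i. F i \<noteq> \<zero>\<^bsub>R\<^esub> \<and> G (k - i) \<noteq> \<zero>\<^bsub>R\<^esub>}. F i \<otimes>\<^bsub>R\<^esub> G (k - i)),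
      one = (\<lambda>k. if k = 0 then \<one>\<^bsub>R\<^esub> else \<zero>\<^bsub>R\<^esub>),
      zero = (\<lambda>k. \<zero>\<^bsub>R\<^esub>),
      add = (\<lambda>F G k. F k \<oplus>\<^bsub>R\<^esub> G k) \<rparr>"

definition laurent_const :: "('a, 'm) ring_scheme \<Rightarrow> 'a \<Rightarrow> int \<Rightarrow> 'a" where
  "laurent_const R a = (\<lambda>k. if k = 0 then a else \<zero>\<^bsub>R\<^esub>)"

definition laurent_q :: "('a, 'm) ring_scheme \<Rightarrow> int \<Rightarrow> 'a" where
  "laurent_q R = (\<lambda>k. if k = 1 then \<one>\<^bsub>R\<^esub> else \<zero>\<^bsub>R\<^esub>)"

text \<open>Only meaningful for nonzero \<open>F\<close>.\<close>

definition laurent_deg :: "('a, 'm) ring_scheme \<Rightarrow> (int \<Rightarrow> 'a) \<Rightarrow> int" where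
  "laurent_deg R F = (GREATEST k. F k \<noteq> \<zero>\<^bsub>R\<^esub>)"

text \<open>Specialisation of the inverse of \<open>q\<close> to 0; only meaningful for power series in the inverse
  of \<open>q\<close>, that is, when no positive power of \<open>q\<close> occurs in \<open>F\<close>.\<close>

definition sp0 :: "(int \<Rightarrow> 'a) \<Rightarrow> 'a" where
  "sp0 F = F 0"

definition regular_elems :: "('a, 'm) ring_scheme \<Rightarrow> 'a set" where
  "regular_elems R = {s \<in> carrier R. \<forall>a\<in>carrier R. a \<otimes>\<^bsub>R\<^esub> s = \<zero>\<^bsub>R\<^esub> \<longrightarrow> a = \<zero>\<^bsub>R\<^esub>}"

definition frac_class :: "('a, 'm) ring_scheme \<Rightarrow> 'a \<Rightarrow> 'a \<Rightarrow> ('a \<times> 'a) set" where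
  "frac_class R a s =
     {(b, t). b \<in> carrier R \<and> t \<in> regular_elems R \<and> a \<otimes>\<^bsub>R\<^esub> t = b \<otimes>\<^bsub>R\<^esub> s}"

definition total_frac :: "('a, 'm) ring_scheme \<Rightarrow> ('a \<times> 'a) set ring" where
  "total_frac R =
    \<lparr> carrier = {frac_class R a s | a s. a \<in> carrier R \<and> s \<in> regular_elems R},
      monoid.mult = (\<lambda>X Y. \<Union>(a, s)\<in>X. \<Union>(b, t)\<in>Y. frac_class R (a \<otimes>\<^bsub>R\<^esub> b) (s \<otimes>\<^bsub>R\<^esub> t)),
      one = frac_class R \<one>\<^bsub>R\<^esub> \<one>\<^bsub>R\<^esub>,
      zero = frac_class R \<zero>\<^bsub>R\<^esub> \<one>\<^bsub>R\<^esub>,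
      add = (\<lambda>X Y. \<Union>(a, s)\<in>X. \<Union>(b, t)\<in>Y.
        frac_class R (a \<otimes>\<^bsub>R\<^esub> t \<oplus>\<^bsub>R\<^esub> b \<otimes>\<^bsub>R\<^esub> s) (s \<otimes>\<^bsub>R\<^esub> t)) \<rparr>"

definition frac_embed :: "('a, 'm) ring_scheme \<Rightarrow> 'a \<Rightarrow> ('a \<times> 'a) set" where
  "frac_embed R a = frac_class R a \<one>\<^bsub>R\<^esub>"


section \<open>The ring of coefficients\<close>

text \<open>\<open>P\<close> is presented as the free abelian group on \<open>{1..n + 1}\<close> modulo the sum of its generators.
  All abelian groups are in the multiplicative notation of the library, so that \<open>\<otimes>\<close> and \<open>inv\<close> in
  \<open>P_group\<close> and \<open>PQ_group\<close> stand for addition and negation.\<close>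

definition sum_subgroup :: "nat \<Rightarrow> (nat \<Rightarrow>\<^sub>0 int) set" where
  "sum_subgroup n =
     generate (free_Abelian_group {1..n+1}) {\<Sum>j\<in>{1..n+1}. Poly_Mapping.single j 1}"

definition P_group :: "nat \<Rightarrow> (nat \<Rightarrow>\<^sub>0 int) set monoid" where
  "P_group n = free_Abelian_group {1..n+1} Mod sum_subgroup n"

definition P_gen :: "nat \<Rightarrow> nat \<Rightarrow> (nat \<Rightarrow>\<^sub>0 int) set" where
  "P_gen n j = sum_subgroup n #>\<^bsub>free_Abelian_group {1..n+1}\<^esub> Poly_Mapping.single j 1"

definition Q_subgroup :: "nat \<Rightarrow> nat list \<Rightarrow> (nat \<Rightarrow>\<^sub>0 int) set set" where
  "Q_subgroup n lam = generate (P_group n)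
     {P_gen n j \<otimes>\<^bsub>P_group n\<^esub> inv\<^bsub>P_group n\<^esub> P_gen n k
       | i j k. i < length lam \<and> j \<in> row lam i \<and> k \<in> row lam i}"

type_synonym pq = "(nat \<Rightarrow>\<^sub>0 int) set set"

definition PQ_group :: "nat \<Rightarrow> nat list \<Rightarrow> pq monoid" where
  "PQ_group n lam = P_group n Mod Q_subgroup n lam"

text \<open>The class of \<open>e\<close> at the first entry of row \<open>i\<close>; it is the same for all entries of the row.\<close>

definition e_row :: "nat \<Rightarrow> nat list \<Rightarrow> nat \<Rightarrow> pq" where
  "e_row n lam i = Q_subgroup n lam #>\<^bsub>P_group n\<^esub> P_gen n (Suc (sum_list (take i lam)))"

definition Phi_G :: "nat \<Rightarrow> nat list \<Rightarrow> pq set" where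
  "Phi_G n lam = {e_row n lam i \<otimes>\<^bsub>PQ_group n lam\<^esub> inv\<^bsub>PQ_group n lam\<^esub> e_row n lam j
     | i j. i < length lam \<and> j < length lam \<and> i \<noteq> j \<and> lam ! i = lam ! j}"

definition zeta_ring :: "nat \<Rightarrow> nat list \<Rightarrow> (pq \<Rightarrow>\<^sub>0 int) ring" where
  "zeta_ring n lam = group_ring (PQ_group n lam)"

definition zeta :: "pq \<Rightarrow> (pq \<Rightarrow>\<^sub>0 int)" where
  "zeta \<gamma> = Poly_Mapping.single \<gamma> 1"


section \<open>The rational functions\<close>

text \<open>The following two products are written over an arbitrary commutative ring \<open>K\<close>, which will be
  the total ring of fractions of the ring of Laurent series.\<close>

definition C_fun ::
  "('a, 'm) ring_scheme \<Rightarrow> 'a \<Rightarrow> nat \<Rightarrow> nat list \<Rightarrow> 'a" where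
  "C_fun K q n lam = q [^]\<^bsub>K\<^esub> (- (int n * (int n + 1))) \<otimes>\<^bsub>K\<^esub>
     (\<Otimes>\<^bsub>K\<^esub>i\<in>{..<length lam}.
        q [^]\<^bsub>K\<^esub> ((int (lam ! i))\<^sup>2 - int (lam ! i))
          \<otimes>\<^bsub>K\<^esub> (\<one>\<^bsub>K\<^esub> \<ominus>\<^bsub>K\<^esub> q [^]\<^bsub>K\<^esub> (- 2 :: int)) [^]\<^bsub>K\<^esub> (lam ! i)
          \<otimes>\<^bsub>K\<^esub> inv\<^bsub>K\<^esub> (\<one>\<^bsub>K\<^esub> \<ominus>\<^bsub>K\<^esub> q [^]\<^bsub>K\<^esub> (- 2 * int (lam ! i))))"

definition c_fun ::
  "('a, 'm) ring_scheme \<Rightarrow> 'a \<Rightarrow> (nat \<Rightarrow> 'a) \<Rightarrow> nat list \<Rightarrow> 'a" where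
  "c_fun K v z lam =
     finprod K (\<lambda>(i, j, k).
        (\<one>\<^bsub>K\<^esub> \<ominus>\<^bsub>K\<^esub> v [^]\<^bsub>K\<^esub> (int (lam ! i) - int (lam ! j) + 2 * int k)
             \<otimes>\<^bsub>K\<^esub> inv\<^bsub>K\<^esub> (z i) \<otimes>\<^bsub>K\<^esub> z j)
          \<otimes>\<^bsub>K\<^esub> inv\<^bsub>K\<^esub> (\<one>\<^bsub>K\<^esub> \<ominus>\<^bsub>K\<^esub> v [^]\<^bsub>K\<^esub> (- int (lam ! i) - int (lam ! j) + 2 * int k)
             \<otimes>\<^bsub>K\<^esub> inv\<^bsub>K\<^esub> (z i) \<otimes>\<^bsub>K\<^esub> z j))
       {(i, j, k). i < j \<and> j < length lam \<and> 1 \<le> k \<and> k \<le> lam ! j}"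

definition series_ring :: "nat \<Rightarrow> nat list \<Rightarrow> (int \<Rightarrow> pq \<Rightarrow>\<^sub>0 int) ring" where
  "series_ring n lam = laurent_ring (zeta_ring n lam)"

type_synonym pq_frac = "((int \<Rightarrow> pq \<Rightarrow>\<^sub>0 int) \<times> (int \<Rightarrow> pq \<Rightarrow>\<^sub>0 int)) set"

text \<open>The factors of \<open>c_fun\<close> with \<open>lam ! i = lam ! j\<close> and \<open>k = lam ! j\<close> have denominators free of
  \<open>q\<close>, which are regular elements but not units of \<open>series_ring n lam\<close>. Moreover that ring has zero
  divisors when \<open>P / Q\<close> has torsion. Therefore \<open>c_fun\<close> is formed in its total ring of fractions.\<close>

definition frac_ring :: "nat \<Rightarrow> nat list \<Rightarrow> pq_frac ring" where
  "frac_ring n lam = total_frac (series_ring n lam)"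

definition q_elem :: "nat \<Rightarrow> nat list \<Rightarrow> pq_frac" where
  "q_elem n lam = frac_embed (series_ring n lam) (laurent_q (zeta_ring n lam))"

definition v_elem :: "nat \<Rightarrow> nat list \<Rightarrow> pq_frac" where
  "v_elem n lam = \<ominus>\<^bsub>frac_ring n lam\<^esub> (inv\<^bsub>frac_ring n lam\<^esub> q_elem n lam)"

definition z_elem :: "nat \<Rightarrow> nat list \<Rightarrow> nat \<Rightarrow> pq_frac" where
  "z_elem n lam i =
     frac_embed (series_ring n lam) (laurent_const (zeta_ring n lam) (zeta (e_row n lam i)))"

definition C_quotient :: "nat \<Rightarrow> nat list \<Rightarrow> pq_frac" where
  "C_quotient n lam =
     (let K = frac_ring n lam; q = q_elem n lam; v = v_elem n lam; z = z_elem n lam in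
       C_fun K q n lam \<otimes>\<^bsub>K\<^esub>
         inv\<^bsub>K\<^esub> (c_fun K v z lam \<otimes>\<^bsub>K\<^esub> c_fun K v (\<lambda>i. inv\<^bsub>K\<^esub> (z i)) lam))"

text \<open>The Laurent series that an element of \<open>frac_ring n lam\<close> is equal to, if there is one. The
  expansion of the inverse of \<open>1 - v\<^sup>m x\<close> with \<open>m > 0\<close> is the geometric series, because the
  latter is the inverse in \<open>series_ring n lam\<close>.\<close>

definition expansion :: "nat \<Rightarrow> nat list \<Rightarrow> pq_frac \<Rightarrow> (int \<Rightarrow> pq \<Rightarrow>\<^sub>0 int)" where
  "expansion n lam x =
     (THE F. F \<in> carrier (series_ring n lam) \<and> frac_embed (series_ring n lam) F = x)"

end

theory Submission
  imports Defs
begin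

text \<open>Every factor of the quotient has a leading term. The numerators \<open>1 - v\<^sup>m x\<close> of
  \<open>c_fun\<close> have \<open>m > 0\<close> and hence leading term 1. A denominator equals \<open>1 - v\<^sup>-\<^sup>m x\<close> with
  \<open>m = \<lambda>\<^sub>i + \<lambda>\<^sub>j - 2 k \<ge> 0\<close>. For \<open>m > 0\<close> its leading terms at \<open>x\<close> and at
  the inverse of \<open>x\<close> multiply to \<open>q\<close> to the power \<open>2 m\<close>; for \<open>m = 0\<close>, which
  means \<open>\<lambda>\<^sub>i = \<lambda>\<^sub>j = k\<close>, the two denominators are constant and contribute the factors of the
  product over \<open>\<Phi>\<close>. These constants are regular because differences of distinct rows have
  infinite order in \<open>P / Q\<close>, so they are invertible in the total ring of fractions and no
  leading coefficient is lost to a zero divisor. The exponents add up to the stated degree by the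
  expansion of the square of \<open>n + 1 = \<Sum> \<lambda>\<^sub>i\<close>.\<close>

section \<open>Group rings\<close>

text \<open>The quotient stays within reach of Laurent series because \<open>c_fun\<close> enters it
  only inverted. Inversion turns the denominators of \<open>c_fun\<close>, including the constant
  ones that need not be invertible as series, into numerators; what remains to be expanded are
  factors 1 - v^m x with m > 0. Hence each factor of \<open>c_fun\<close> is only required to be a
  unit of the total ring of fractions, and leading terms are followed for the inverses alone. While
  they are multiplied, leading coefficients are allowed to be zero; that the final one is nonzero is
  derived once, from the fact that products of regular elements are regular. The product over
  \<open>Phi_G\<close> runs over a set, whereas the calculation yields one factor per ordered pair
  of rows. The integer weights that show differences of rows to have infinite order also tell these
  differences apart, which makes the two products agree. The length is obtained as a number of
  inversions, counted by columns and then regrouped by rows: a box in row i, counted from 0,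
  contributes i.\<close>

lemma group_ring_mult_eq_frag_extend:
  "f \<otimes>\<^bsub>group_ring G\<^esub> g = frag_extend (\<lambda>x. frag_extend (\<lambda>y. frag_of (x \<otimes>\<^bsub>G\<^esub> y)) g) f"
proof -
  have "Poly_Mapping.single z (a * b) = frag_cmul a (frag_cmul b (frag_of z))" for z :: 'a and a b
    by (rule poly_mapping_eqI) (simp add: lookup_single when_def)
  then show ?thesis
    by (simp add: group_ring_def frag_extend_def frag_cmul_sum)
qed

lemma group_ring_simps:
  "carrier (group_ring G) = {f. Poly_Mapping.keys f \<subseteq> carrier G}"
  "\<one>\<^bsub>group_ring G\<^esub> = frag_of \<one>\<^bsub>G\<^esub>"
  "\<zero>\<^bsub>group_ring G\<^esub> = 0"
  "f \<oplus>\<^bsub>group_ring G\<^esub> g = f + g"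
  by (simp_all add: group_ring_def)

lemma group_ring_mult_frag_of:
  "frag_of x \<otimes>\<^bsub>group_ring G\<^esub> frag_of y = frag_of (x \<otimes>\<^bsub>G\<^esub> y)"
  by (simp add: group_ring_mult_eq_frag_extend)

lemma frag_cmul_diff_distrib2: "frag_cmul k (a - b) = frag_cmul k a - frag_cmul k b"
  by (rule poly_mapping_eqI) (simp add: lookup_minus right_diff_distrib)

lemma frag_extend_diff_fun:
  "frag_extend (\<lambda>x. f x - g x) c = frag_extend f c - frag_extend g c"
  by (simp add: frag_extend_def frag_cmul_diff_distrib2 sum_subtractf)

lemma group_ring_mult_diff:
  "(f - g) \<otimes>\<^bsub>group_ring G\<^esub> h = f \<otimes>\<^bsub>group_ring G\<^esub> h - g \<otimes>\<^bsub>group_ring G\<^esub> h"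
  "h \<otimes>\<^bsub>group_ring G\<^esub> (f - g) = h \<otimes>\<^bsub>group_ring G\<^esub> f - h \<otimes>\<^bsub>group_ring G\<^esub> g"
  by (simp_all add: group_ring_mult_eq_frag_extend frag_extend_diff frag_extend_diff_fun)

lemma group_ring_mult_zero:
  "0 \<otimes>\<^bsub>group_ring G\<^esub> h = 0" "h \<otimes>\<^bsub>group_ring G\<^esub> 0 = 0"
  using group_ring_mult_diff(1)[of G 0 0] group_ring_mult_diff(2)[of G h 0 0] by simp_all

lemma group_ring_mult_add:
  "(f + g) \<otimes>\<^bsub>group_ring G\<^esub> h = f \<otimes>\<^bsub>group_ring G\<^esub> h + g \<otimes>\<^bsub>group_ring G\<^esub> h"
  using group_ring_mult_diff(1)[of G "f + g" g h] by (simp add: algebra_simps)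

lemma keys_group_ring_mult:
  assumes "comm_group G" "Poly_Mapping.keys f \<subseteq> carrier G" "Poly_Mapping.keys g \<subseteq> carrier G"
  shows "Poly_Mapping.keys (f \<otimes>\<^bsub>group_ring G\<^esub> g) \<subseteq> carrier G"
proof -
  interpret comm_group G by fact
  show ?thesis
    unfolding group_ring_mult_eq_frag_extend
    using assms(2,3)
    by (intro order.trans[OF keys_frag_extend] UN_least) auto
qed

text \<open>Multiplication is bilinear, so \<open>frag_induction\<close> on each argument reduces
  every law to basis elements, where it is a law of the group.\<close>

lemma cring_group_ring:
  assumes "comm_group G"
  shows "cring (group_ring G)"
proof -
  interpret G: comm_group G by fact
  let ?R = "group_ring G"
  have comm: "f \<otimes>\<^bsub>?R\<^esub> g = g \<otimes>\<^bsub>?R\<^esub> f"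
    if f: "Poly_Mapping.keys f \<subseteq> carrier G" and g: "Poly_Mapping.keys g \<subseteq> carrier G" for f g
    using f
  proof (induction f rule: frag_induction)
    case (one x)
    show ?case using g
      by (induction g rule: frag_induction)
        (use one in \<open>simp_all add: group_ring_mult_zero group_ring_mult_diff group_ring_mult_frag_of G.m_comm\<close>)
  qed (simp_all add: group_ring_mult_zero group_ring_mult_diff)
  have assoc: "f \<otimes>\<^bsub>?R\<^esub> g \<otimes>\<^bsub>?R\<^esub> h = f \<otimes>\<^bsub>?R\<^esub> (g \<otimes>\<^bsub>?R\<^esub> h)"
    if f: "Poly_Mapping.keys f \<subseteq> carrier G" and g: "Poly_Mapping.keys g \<subseteq> carrier G"
      and h: "Poly_Mapping.keys h \<subseteq> carrier G" for f g h
    using f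
  proof (induction f rule: frag_induction)
    case x: (one x)
    show ?case using g
    proof (induction g rule: frag_induction)
      case y: (one y)
      show ?case using h
        by (induction h rule: frag_induction)
          (use x y in \<open>simp_all add: group_ring_mult_zero group_ring_mult_diff group_ring_mult_frag_of
              G.m_assoc\<close>)
    qed (simp_all add: group_ring_mult_zero group_ring_mult_diff)
  qed (simp_all add: group_ring_mult_zero group_ring_mult_diff)
  have one: "frag_of \<one>\<^bsub>G\<^esub> \<otimes>\<^bsub>?R\<^esub> f = f" if "Poly_Mapping.keys f \<subseteq> carrier G" for f
    using that
    by (induction f rule: frag_induction)
      (simp_all add: group_ring_mult_zero group_ring_mult_diff group_ring_mult_frag_of)
  show ?thesis
  proof (rule cringI)
    show "abelian_group ?R"
    proof (rule abelian_groupI)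
      fix f g assume "f \<in> carrier ?R" "g \<in> carrier ?R"
      then show "f \<oplus>\<^bsub>?R\<^esub> g \<in> carrier ?R"
        using keys_add[of f g] by (auto simp: group_ring_simps)
    next
      fix f assume "f \<in> carrier ?R"
      then show "\<exists>g\<in>carrier ?R. g \<oplus>\<^bsub>?R\<^esub> f = \<zero>\<^bsub>?R\<^esub>"
        by (intro bexI[of _ "- f"]) (simp_all add: group_ring_simps)
    qed (simp_all add: group_ring_simps algebra_simps)
    show "Group.comm_monoid ?R"
      by (rule comm_monoidI)
        (simp_all add: group_ring_simps keys_group_ring_mult[OF assms] assoc one, simp add: comm)
  qed (simp add: group_ring_simps group_ring_mult_add)
qed

lemma group_ring_minus:
  assumes "comm_group G" "f \<in> carrier (group_ring G)" "g \<in> carrier (group_ring G)"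
  shows "f \<ominus>\<^bsub>group_ring G\<^esub> g = f - g"
proof -
  interpret cring "group_ring G" by (rule cring_group_ring) fact
  have "\<ominus>\<^bsub>group_ring G\<^esub> g = - g"
    using assms by (intro minus_equality) (simp_all add: group_ring_simps)
  then show ?thesis by (simp add: minus_eq group_ring_simps)
qed

lemma Units_group_ring:
  assumes "comm_group G" "x \<in> carrier G"
  shows "frag_of x \<in> Units (group_ring G)"
    "inv\<^bsub>group_ring G\<^esub> frag_of x = frag_of (inv\<^bsub>G\<^esub> x)"
proof -
  interpret G: comm_group G by fact
  interpret cring "group_ring G" by (rule cring_group_ring) fact
  have *: "frag_of x \<otimes>\<^bsub>group_ring G\<^esub> frag_of (inv\<^bsub>G\<^esub> x) = \<one>\<^bsub>group_ring G\<^esub>"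
    using assms by (simp add: group_ring_mult_frag_of group_ring_simps)
  have c: "frag_of x \<in> carrier (group_ring G)" "frag_of (inv\<^bsub>G\<^esub> x) \<in> carrier (group_ring G)"
    using assms by (simp_all add: group_ring_simps)
  show "inv\<^bsub>group_ring G\<^esub> frag_of x = frag_of (inv\<^bsub>G\<^esub> x)"
    using * c by (intro comm_inv_char)
  show "frag_of x \<in> Units (group_ring G)"
    using * c m_comm[OF c] unfolding Units_def by auto
qed

text \<open>Translation by \<open>g\<close> is injective, so the coefficient at \<open>x\<close> is
  moved without meeting another one.\<close>

lemma lookup_group_ring_mult_frag_of:
  assumes "comm_group G" "f \<in> carrier (group_ring G)" "x \<in> carrier G" "g \<in> carrier G"
  shows "Poly_Mapping.lookup (f \<otimes>\<^bsub>group_ring G\<^esub> frag_of g) (x \<otimes>\<^bsub>G\<^esub> g) = Poly_Mapping.lookup f x"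
proof -
  interpret comm_group G by fact
  have "Poly_Mapping.keys f \<subseteq> carrier G" using assms by (simp add: group_ring_simps)
  then show ?thesis
    by (induction f rule: frag_induction)
      (use assms in \<open>simp_all add: group_ring_mult_zero group_ring_mult_diff group_ring_mult_frag_of
        lookup_minus\<close>)
qed

text \<open>A nonzero element fixed by multiplication with \<open>g\<close> would have a support that is stable under
  translation by \<open>g\<close>; the additive function \<open>\<psi>\<close> has no extremum on such a set.\<close>

lemma regular_one_minus_frag_of:
  fixes \<psi> :: "'g \<Rightarrow> int"
  assumes "comm_group G" "g \<in> carrier G" and "\<psi> g \<noteq> 0"
    and hom: "\<And>x y. x \<in> carrier G \<Longrightarrow> y \<in> carrier G \<Longrightarrow> \<psi> (x \<otimes>\<^bsub>G\<^esub> y) = \<psi> x + \<psi> y"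
  shows "\<one>\<^bsub>group_ring G\<^esub> \<ominus>\<^bsub>group_ring G\<^esub> frag_of g \<in> regular_elems (group_ring G)"
proof -
  let ?R = "group_ring G"
  interpret G: comm_group G by fact
  interpret cring ?R by (rule cring_group_ring) fact
  have g: "frag_of g \<in> carrier ?R"
    using assms(2) by (simp add: group_ring_simps)
  have "a = \<zero>\<^bsub>?R\<^esub>" if a: "a \<in> carrier ?R" and eq: "a \<otimes>\<^bsub>?R\<^esub> (\<one>\<^bsub>?R\<^esub> \<ominus>\<^bsub>?R\<^esub> frag_of g) = \<zero>\<^bsub>?R\<^esub>" for a
  proof (rule ccontr)
    assume "a \<noteq> \<zero>\<^bsub>?R\<^esub>"
    then have ne: "Poly_Mapping.keys a \<noteq> {}" by (simp add: group_ring_simps)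
    have "a \<ominus>\<^bsub>?R\<^esub> a \<otimes>\<^bsub>?R\<^esub> frag_of g = \<zero>\<^bsub>?R\<^esub>"
      using eq a g by algebra
    then have ag: "a \<otimes>\<^bsub>?R\<^esub> frag_of g = a"
      using a g by (simp add: group_ring_minus[OF assms(1)] group_ring_simps(3))
    \<comment> \<open>The sign makes translation by \<open>g\<close> strictly increase
      \<open>h\<close> whether \<psi> is positive or negative at \<open>g\<close>, so a maximum
      settles both cases.\<close>
    define h where "h = (\<lambda>x. sgn (\<psi> g) * \<psi> x)"
    have "Max (h ` Poly_Mapping.keys a) \<in> h ` Poly_Mapping.keys a"
      using ne by (intro Max_in) auto
    then obtain x where x: "x \<in> Poly_Mapping.keys a" and "h x = Max (h ` Poly_Mapping.keys a)"
      by auto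
    then have max: "h y \<le> h x" if "y \<in> Poly_Mapping.keys a" for y
      using that by simp
    have xG: "x \<in> carrier G" using x a by (auto simp: group_ring_simps)
    have "Poly_Mapping.lookup a (x \<otimes>\<^bsub>G\<^esub> g) = Poly_Mapping.lookup a x"
      using lookup_group_ring_mult_frag_of[OF assms(1) a xG assms(2)] ag by simp
    then have "h (x \<otimes>\<^bsub>G\<^esub> g) \<le> h x"
      using x by (intro max) (simp add: in_keys_iff)
    then have "sgn (\<psi> g) * \<psi> g \<le> 0"
      using xG assms(2) by (simp add: h_def hom distrib_left)
    then show False using \<open>\<psi> g \<noteq> 0\<close> by (simp add: sgn_if split: if_splits)
  qed
  then show ?thesis using g by (auto simp: regular_elems_def)
qed

section \<open>Rings of Laurent series\<close>

lemma (in comm_monoid) finprod_swap: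
  assumes "finite A" "finite B" "\<And>i j. i \<in> A \<Longrightarrow> j \<in> B \<Longrightarrow> f i j \<in> carrier G"
  shows "(\<Otimes>i\<in>A. \<Otimes>j\<in>B. f i j) = (\<Otimes>j\<in>B. \<Otimes>i\<in>A. f i j)"
  using assms(1,3)
proof (induction A rule: finite_induct)
  case empty
  then show ?case by simp
next
  case (insert a A)
  then have "(\<Otimes>j\<in>B. \<Otimes>i\<in>insert a A. f i j) = (\<Otimes>j\<in>B. f a j \<otimes> (\<Otimes>i\<in>A. f i j))"
    by (intro finprod_cong') (auto intro!: finprod_insert finprod_closed m_closed)
  also have "\<dots> = (\<Otimes>j\<in>B. f a j) \<otimes> (\<Otimes>j\<in>B. \<Otimes>i\<in>A. f i j)"
    using insert.prems by (intro finprod_multf) (auto intro!: finprod_closed)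
  also have "\<dots> = (\<Otimes>i\<in>insert a A. \<Otimes>j\<in>B. f i j)"
    using insert by (subst finprod_insert) (auto intro!: finprod_closed)
  finally show ?case ..
qed

lemmas (in abelian_monoid) finsum_swap = add.finprod_swap
lemmas (in abelian_monoid) finsum_mono_neutral_cong_left = add.finprod_mono_neutral_cong_left

definition laurent_monom :: "('a, 'm) ring_scheme \<Rightarrow> 'a \<Rightarrow> int \<Rightarrow> int \<Rightarrow> 'a" where
  "laurent_monom R a e = (\<lambda>k. if k = e then a else \<zero>\<^bsub>R\<^esub>)"

lemma laurent_const_eq_monom: "laurent_const R a = laurent_monom R a 0"
  by (simp add: laurent_const_def laurent_monom_def)

lemma laurent_q_eq_monom: "laurent_q R = laurent_monom R \<one>\<^bsub>R\<^esub> 1"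
  by (simp add: laurent_q_def laurent_monom_def)

lemma laurent_ring_simps:
  "carrier (laurent_ring R) = {F. (\<forall>k. F k \<in> carrier R) \<and> (\<exists>d. \<forall>k>d. F k = \<zero>\<^bsub>R\<^esub>)}"
  "\<one>\<^bsub>laurent_ring R\<^esub> = laurent_monom R \<one>\<^bsub>R\<^esub> 0"
  "\<zero>\<^bsub>laurent_ring R\<^esub> = (\<lambda>k. \<zero>\<^bsub>R\<^esub>)"
  "F \<oplus>\<^bsub>laurent_ring R\<^esub> G = (\<lambda>k. F k \<oplus>\<^bsub>R\<^esub> G k)"
  by (simp_all add: laurent_ring_def laurent_monom_def)

lemma laurent_carrier_bounded:
  assumes "F \<in> carrier (laurent_ring R)"
  obtains d where "\<And>k. d < k \<Longrightarrow> F k = \<zero>\<^bsub>R\<^esub>"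
  using assms by (auto simp: laurent_ring_simps)

lemma laurent_carrier_coeff:
  "F \<in> carrier (laurent_ring R) \<Longrightarrow> F k \<in> carrier R"
  by (simp add: laurent_ring_simps)

context cring
begin

abbreviation (input) "L \<equiv> laurent_ring R"

text \<open>The defining sum runs over an index set that depends on both series. Adding vanishing
  terms gives index sets that several products can share, as distributivity and associativity
  require.\<close>

lemma laurent_mult_coeff:
  assumes F: "F \<in> carrier L" and G: "G \<in> carrier L"
    and "finite A" and "\<And>i. F i \<noteq> \<zero> \<Longrightarrow> G (k - i) \<noteq> \<zero> \<Longrightarrow> i \<in> A"
  shows "(F \<otimes>\<^bsub>L\<^esub> G) k = (\<Oplus>i\<in>A. F i \<otimes> G (k - i))"
proof -
  have [simp]: "F i \<in> carrier R" "G i \<in> carrier R" for i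
    using F G by (simp_all add: laurent_carrier_coeff)
  show ?thesis unfolding laurent_ring_def monoid.simps
    using assms(3,4)
    by (auto intro!: finsum_mono_neutral_cong_left)
qed

lemma laurent_mult_coeff_interval:
  assumes "F \<in> carrier L" "G \<in> carrier L"
    and "\<And>i. d < i \<Longrightarrow> F i = \<zero>" "\<And>i. e < i \<Longrightarrow> G i = \<zero>"
    and "a \<le> k - e" "d \<le> b"
  shows "(F \<otimes>\<^bsub>L\<^esub> G) k = (\<Oplus>i\<in>{a..b}. F i \<otimes> G (k - i))"
proof (intro laurent_mult_coeff assms(1,2))
  fix i assume "F i \<noteq> \<zero>" "G (k - i) \<noteq> \<zero>"
  then have "i \<le> d" "k - i \<le> e" using assms(3,4) by (meson not_le)+
  then show "i \<in> {a..b}" using assms(5,6) by simp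
qed simp

lemma laurent_mult_coeff_eq_zero:
  assumes "F \<in> carrier L" "G \<in> carrier L"
    and "\<And>i. d < i \<Longrightarrow> F i = \<zero>" "\<And>i. e < i \<Longrightarrow> G i = \<zero>" and "d + e < k"
  shows "(F \<otimes>\<^bsub>L\<^esub> G) k = \<zero>"
  using laurent_mult_coeff_interval[of F G d e "k - e" k d] assms by simp

lemma laurent_mult_closed:
  assumes F: "F \<in> carrier L" and G: "G \<in> carrier L"
  shows "F \<otimes>\<^bsub>L\<^esub> G \<in> carrier L"
proof -
  obtain d where d: "\<And>k. d < k \<Longrightarrow> F k = \<zero>" using F by (rule laurent_carrier_bounded) blast
  obtain e where e: "\<And>k. e < k \<Longrightarrow> G k = \<zero>" using G by (rule laurent_carrier_bounded) blast
  have "(F \<otimes>\<^bsub>L\<^esub> G) k \<in> carrier R" for k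
    by (subst laurent_mult_coeff_interval[OF F G d e order.refl order.refl])
      (use F G in \<open>auto intro!: finsum_closed simp: laurent_carrier_coeff\<close>)
  then show ?thesis
    using laurent_mult_coeff_eq_zero[OF F G d e] unfolding laurent_ring_simps by blast
qed

lemma laurent_mult_comm:
  assumes F: "F \<in> carrier L" and G: "G \<in> carrier L"
  shows "F \<otimes>\<^bsub>L\<^esub> G = G \<otimes>\<^bsub>L\<^esub> F"
proof
  fix k
  obtain d where d: "\<And>k. d < k \<Longrightarrow> F k = \<zero>" using F by (rule laurent_carrier_bounded) blast
  obtain e where e: "\<And>k. e < k \<Longrightarrow> G k = \<zero>" using G by (rule laurent_carrier_bounded) blast
  have [simp]: "F i \<in> carrier R" "G i \<in> carrier R" for i
    using F G by (simp_all add: laurent_carrier_coeff)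
  have "{k - d..e} = (\<lambda>i. k - i) ` {k - e..d}"
    by (auto simp: image_iff intro!: bexI[of _ "k - _"])
  then have "(G \<otimes>\<^bsub>L\<^esub> F) k = (\<Oplus>j\<in>(\<lambda>i. k - i) ` {k - e..d}. G j \<otimes> F (k - j))"
    using laurent_mult_coeff_interval[OF G F e d order.refl order.refl] by simp
  also have "\<dots> = (\<Oplus>i\<in>{k - e..d}. G (k - i) \<otimes> F (k - (k - i)))"
    by (rule finsum_reindex) (auto simp: inj_on_def)
  also have "\<dots> = (\<Oplus>i\<in>{k - e..d}. F i \<otimes> G (k - i))"
    by (simp add: m_comm)
  also have "\<dots> = (F \<otimes>\<^bsub>L\<^esub> G) k"
    using laurent_mult_coeff_interval[OF F G d e order.refl order.refl] by simp
  finally show "(F \<otimes>\<^bsub>L\<^esub> G) k = (G \<otimes>\<^bsub>L\<^esub> F) k" ..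
qed

lemma laurent_mult_assoc:
  assumes F: "F \<in> carrier L" and G: "G \<in> carrier L" and H: "H \<in> carrier L"
  shows "F \<otimes>\<^bsub>L\<^esub> G \<otimes>\<^bsub>L\<^esub> H = F \<otimes>\<^bsub>L\<^esub> (G \<otimes>\<^bsub>L\<^esub> H)"
proof
  fix k
  obtain d where d: "\<And>k. d < k \<Longrightarrow> F k = \<zero>" using F by (rule laurent_carrier_bounded) blast
  obtain e where e: "\<And>k. e < k \<Longrightarrow> G k = \<zero>" using G by (rule laurent_carrier_bounded) blast
  obtain g where g: "\<And>k. g < k \<Longrightarrow> H k = \<zero>" using H by (rule laurent_carrier_bounded) blast
  have [simp]: "F i \<in> carrier R" "G i \<in> carrier R" "H i \<in> carrier R" for i
    using F G H by (simp_all add: laurent_carrier_coeff)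
  note FG = laurent_mult_closed[OF F G] and GH = laurent_mult_closed[OF G H]
  \<comment> \<open>In a nonzero triple product the exponents of \<open>F\<close>, \<open>G\<close>,
    \<open>H\<close> are j, i - j, k - i. The bounds \<open>d\<close>, \<open>e\<close>,
    \<open>g\<close> confine i to \<open>I\<close> and j to \<open>J\<close>; neither interval
    depends on the other index, so the sums can be exchanged.\<close>
  define I where "I = {k - g..d + e}"
  define J where "J = {k - g - e..d}"
  have FG_coeff: "(F \<otimes>\<^bsub>L\<^esub> G) i = (\<Oplus>j\<in>J. F j \<otimes> G (i - j))" if "i \<in> I" for i
    unfolding J_def by (rule laurent_mult_coeff_interval[OF F G d e]) (use that in \<open>auto simp: I_def\<close>)
  have GH_coeff: "(G \<otimes>\<^bsub>L\<^esub> H) (k - j) = (\<Oplus>i\<in>I. G (i - j) \<otimes> H (k - i))" if "j \<in> J" for j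
  proof -
    have "(G \<otimes>\<^bsub>L\<^esub> H) (k - j) = (\<Oplus>i\<in>(\<lambda>i. i - j) ` I. G i \<otimes> H (k - j - i))"
    proof (rule laurent_mult_coeff[OF G H])
      fix i assume "G i \<noteq> \<zero>" "H (k - j - i) \<noteq> \<zero>"
      then have "i \<le> e" "k - j - i \<le> g" using e g by (meson not_le)+
      then show "i \<in> (\<lambda>i. i - j) ` I"
        using that by (auto simp: I_def J_def image_iff intro!: bexI[of _ "i + j"])
    qed (simp add: I_def)
    also have "\<dots> = (\<Oplus>i\<in>I. G (i - j) \<otimes> H (k - j - (i - j)))"
      by (rule finsum_reindex) (auto simp: inj_on_def)
    finally show ?thesis by simp
  qed
  have "(F \<otimes>\<^bsub>L\<^esub> G \<otimes>\<^bsub>L\<^esub> H) k = (\<Oplus>i\<in>I. (F \<otimes>\<^bsub>L\<^esub> G) i \<otimes> H (k - i))"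
    unfolding I_def
    by (rule laurent_mult_coeff_interval[OF FG H _ g]) (auto intro: laurent_mult_coeff_eq_zero[OF F G d e])
  also have "\<dots> = (\<Oplus>i\<in>I. \<Oplus>j\<in>J. F j \<otimes> G (i - j) \<otimes> H (k - i))"
    by (intro finsum_cong') (auto simp: FG_coeff finsum_ldistr J_def)
  also have "\<dots> = (\<Oplus>j\<in>J. \<Oplus>i\<in>I. F j \<otimes> G (i - j) \<otimes> H (k - i))"
    by (rule finsum_swap) (auto simp: I_def J_def)
  also have "\<dots> = (\<Oplus>j\<in>J. F j \<otimes> (G \<otimes>\<^bsub>L\<^esub> H) (k - j))"
    by (intro finsum_cong') (auto simp: GH_coeff finsum_rdistr I_def m_assoc Pi_def)
  also have "\<dots> = (F \<otimes>\<^bsub>L\<^esub> (G \<otimes>\<^bsub>L\<^esub> H)) k"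
    unfolding J_def
    by (rule laurent_mult_coeff_interval[OF F GH d, symmetric])
      (auto intro: laurent_mult_coeff_eq_zero[OF G H e g])
  finally show "(F \<otimes>\<^bsub>L\<^esub> G \<otimes>\<^bsub>L\<^esub> H) k = (F \<otimes>\<^bsub>L\<^esub> (G \<otimes>\<^bsub>L\<^esub> H)) k" .
qed

lemma laurent_mult_distrib:
  assumes F: "F \<in> carrier L" and G: "G \<in> carrier L" and H: "H \<in> carrier L"
    and FG: "F \<oplus>\<^bsub>L\<^esub> G \<in> carrier L"
  shows "(F \<oplus>\<^bsub>L\<^esub> G) \<otimes>\<^bsub>L\<^esub> H = F \<otimes>\<^bsub>L\<^esub> H \<oplus>\<^bsub>L\<^esub> G \<otimes>\<^bsub>L\<^esub> H"
proof
  fix k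
  obtain d where d: "\<And>k. d < k \<Longrightarrow> F k = \<zero>" using F by (rule laurent_carrier_bounded) blast
  obtain e where e: "\<And>k. e < k \<Longrightarrow> G k = \<zero>" using G by (rule laurent_carrier_bounded) blast
  obtain g where g: "\<And>k. g < k \<Longrightarrow> H k = \<zero>" using H by (rule laurent_carrier_bounded) blast
  have [simp]: "F i \<in> carrier R" "G i \<in> carrier R" "H i \<in> carrier R" for i
    using F G H by (simp_all add: laurent_carrier_coeff)
  define I where "I = {k - g..max d e}"
  have "((F \<oplus>\<^bsub>L\<^esub> G) \<otimes>\<^bsub>L\<^esub> H) k = (\<Oplus>i\<in>I. (F \<oplus>\<^bsub>L\<^esub> G) i \<otimes> H (k - i))" unfolding I_def
    by (rule laurent_mult_coeff_interval[OF FG H _ g, of "max d e"]) (auto simp: laurent_ring_simps d e)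
  also have "\<dots> = (\<Oplus>i\<in>I. F i \<otimes> H (k - i) \<oplus> G i \<otimes> H (k - i))"
    by (simp add: laurent_ring_simps l_distr)
  also have "\<dots> = (\<Oplus>i\<in>I. F i \<otimes> H (k - i)) \<oplus> (\<Oplus>i\<in>I. G i \<otimes> H (k - i))"
    by (rule finsum_addf) auto
  also have "(\<Oplus>i\<in>I. F i \<otimes> H (k - i)) = (F \<otimes>\<^bsub>L\<^esub> H) k"
    unfolding I_def by (rule laurent_mult_coeff_interval[OF F H d g, symmetric]) auto
  also have "(\<Oplus>i\<in>I. G i \<otimes> H (k - i)) = (G \<otimes>\<^bsub>L\<^esub> H) k"
    unfolding I_def by (rule laurent_mult_coeff_interval[OF G H e g, symmetric]) auto
  finally show "((F \<oplus>\<^bsub>L\<^esub> G) \<otimes>\<^bsub>L\<^esub> H) k = (F \<otimes>\<^bsub>L\<^esub> H \<oplus>\<^bsub>L\<^esub> G \<otimes>\<^bsub>L\<^esub> H) k"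
    by (simp add: laurent_ring_simps)
qed

lemma laurent_monom_closed [simp]:
  "a \<in> carrier R \<Longrightarrow> laurent_monom R a e \<in> carrier L"
  by (auto simp: laurent_ring_simps laurent_monom_def)

lemma laurent_monom_mult:
  assumes "a \<in> carrier R" "F \<in> carrier L"
  shows "laurent_monom R a e \<otimes>\<^bsub>L\<^esub> F = (\<lambda>k. a \<otimes> F (k - e))"
proof
  fix k
  have "(laurent_monom R a e \<otimes>\<^bsub>L\<^esub> F) k = (\<Oplus>i\<in>{e}. laurent_monom R a e i \<otimes> F (k - i))"
    using assms by (intro laurent_mult_coeff) (auto, simp add: laurent_monom_def split: if_splits)
  then show "(laurent_monom R a e \<otimes>\<^bsub>L\<^esub> F) k = a \<otimes> F (k - e)"
    using assms by (simp add: laurent_carrier_coeff) (simp add: laurent_monom_def)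
qed

lemma laurent_add_closed:
  assumes "F \<in> carrier L" "G \<in> carrier L"
  shows "F \<oplus>\<^bsub>L\<^esub> G \<in> carrier L"
proof -
  obtain d where d: "\<And>k. d < k \<Longrightarrow> F k = \<zero>" using assms(1) by (rule laurent_carrier_bounded) blast
  obtain e where e: "\<And>k. e < k \<Longrightarrow> G k = \<zero>" using assms(2) by (rule laurent_carrier_bounded) blast
  have "\<forall>k>max d e. F k \<oplus> G k = \<zero>" using d e by simp
  then show ?thesis using assms by (auto simp: laurent_ring_simps intro: exI[of _ "max d e"])
qed

lemma cring_laurent_ring: "cring L"
proof (rule cringI)
  show "abelian_group L"
  proof (rule abelian_groupI)
    fix F assume F: "F \<in> carrier L"
    then show "\<exists>G\<in>carrier L. G \<oplus>\<^bsub>L\<^esub> F = \<zero>\<^bsub>L\<^esub>"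
      by (intro bexI[of _ "\<lambda>k. \<ominus> F k"]) (auto simp: laurent_ring_simps l_neg)
  next
    fix F G H assume "F \<in> carrier L" "G \<in> carrier L" "H \<in> carrier L"
    then show "F \<oplus>\<^bsub>L\<^esub> G \<oplus>\<^bsub>L\<^esub> H = F \<oplus>\<^bsub>L\<^esub> (G \<oplus>\<^bsub>L\<^esub> H)"
      by (simp add: laurent_carrier_coeff laurent_ring_simps(4) a_assoc)
  next
    fix F G assume "F \<in> carrier L" "G \<in> carrier L"
    then show "F \<oplus>\<^bsub>L\<^esub> G = G \<oplus>\<^bsub>L\<^esub> F"
      by (simp add: laurent_carrier_coeff laurent_ring_simps(4) a_comm)
  next
    fix F assume "F \<in> carrier L"
    then show "\<zero>\<^bsub>L\<^esub> \<oplus>\<^bsub>L\<^esub> F = F"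
      by (simp add: laurent_carrier_coeff laurent_ring_simps(3,4))
  qed (simp_all add: laurent_add_closed, auto simp: laurent_ring_simps)
  show "Group.comm_monoid L"
  proof (rule comm_monoidI)
    fix F assume F: "F \<in> carrier L"
    show "\<one>\<^bsub>L\<^esub> \<otimes>\<^bsub>L\<^esub> F = F"
      unfolding laurent_ring_simps using F
      by (simp add: laurent_monom_mult laurent_carrier_coeff)
  qed (rule laurent_mult_closed laurent_mult_assoc laurent_mult_comm; assumption |
      simp add: laurent_ring_simps(2))+
  show "(F \<oplus>\<^bsub>L\<^esub> G) \<otimes>\<^bsub>L\<^esub> H = F \<otimes>\<^bsub>L\<^esub> H \<oplus>\<^bsub>L\<^esub> G \<otimes>\<^bsub>L\<^esub> H"
    if "F \<in> carrier L" "G \<in> carrier L" "H \<in> carrier L" for F G H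
    using that by (intro laurent_mult_distrib laurent_add_closed)
qed

lemma laurent_uminus:
  assumes "F \<in> carrier L"
  shows "\<ominus>\<^bsub>L\<^esub> F = (\<lambda>k. \<ominus> F k)"
proof -
  interpret L: cring L by (rule cring_laurent_ring)
  show ?thesis
    using assms by (intro L.minus_equality) (auto simp: laurent_ring_simps l_neg)
qed

lemma laurent_minus:
  assumes "F \<in> carrier L" "G \<in> carrier L"
  shows "F \<ominus>\<^bsub>L\<^esub> G = (\<lambda>k. F k \<ominus> G k)"
  using assms by (simp add: a_minus_def[of L] laurent_uminus) (simp add: laurent_ring_simps a_minus_def)

lemma laurent_monom_mult_monom:
  assumes "a \<in> carrier R" "b \<in> carrier R"
  shows "laurent_monom R a d \<otimes>\<^bsub>L\<^esub> laurent_monom R b e = laurent_monom R (a \<otimes> b) (d + e)"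
  using assms by (intro ext) (simp add: laurent_monom_mult, simp add: laurent_monom_def algebra_simps)

text \<open>The coefficient \<open>a\<close> may be zero, so \<open>d\<close> is only an upper bound
  for the degree. This makes the notion multiplicative in the presence of zero divisors.\<close>

definition laurent_lead :: "(int \<Rightarrow> 'a) \<Rightarrow> int \<Rightarrow> 'a \<Rightarrow> bool" where
  "laurent_lead F d a \<longleftrightarrow> F \<in> carrier L \<and> (\<forall>k>d. F k = \<zero>) \<and> F d = a"

lemma laurent_lead_mult:
  assumes "laurent_lead F d a" "laurent_lead G e b"
  shows "laurent_lead (F \<otimes>\<^bsub>L\<^esub> G) (d + e) (a \<otimes> b)"
proof -
  have F: "F \<in> carrier L" "\<And>i. d < i \<Longrightarrow> F i = \<zero>" "F d = a"
    and G: "G \<in> carrier L" "\<And>i. e < i \<Longrightarrow> G i = \<zero>" "G e = b"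
    using assms by (auto simp: laurent_lead_def)
  have "(F \<otimes>\<^bsub>L\<^esub> G) (d + e) = (\<Oplus>i\<in>{d..d}. F i \<otimes> G (d + e - i))"
    by (rule laurent_mult_coeff_interval[OF F(1) G(1) F(2) G(2)]) auto
  also have "\<dots> = a \<otimes> b"
    using F G laurent_carrier_coeff[of F R] laurent_carrier_coeff[of G R] by auto
  finally show ?thesis
    using laurent_mult_closed[OF F(1) G(1)] laurent_mult_coeff_eq_zero[OF F(1) G(1) F(2) G(2)]
    by (simp add: laurent_lead_def)
qed

lemma laurent_lead_monom:
  "a \<in> carrier R \<Longrightarrow> laurent_lead (laurent_monom R a d) d a"
  by (simp add: laurent_lead_def laurent_monom_closed) (simp add: laurent_monom_def)

lemma laurent_lead_one: "laurent_lead \<one>\<^bsub>L\<^esub> 0 \<one>"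
  unfolding laurent_ring_simps by (rule laurent_lead_monom) simp

lemma laurent_lead_exists:
  assumes "F \<in> carrier L" "F \<noteq> \<zero>\<^bsub>L\<^esub>"
  obtains d where "laurent_lead F d (F d)" "F d \<noteq> \<zero>"
proof -
  obtain b where b: "\<And>k. b < k \<Longrightarrow> F k = \<zero>" using assms(1) by (rule laurent_carrier_bounded) blast
  obtain i where i: "F i \<noteq> \<zero>" using assms(2) by (auto simp: laurent_ring_simps)
  define A where "A = {k. i \<le> k \<and> F k \<noteq> \<zero>}"
  have "k \<le> b" if "F k \<noteq> \<zero>" for k
    using b[of k] that by (cases "b < k") auto
  then have "A \<subseteq> {i..b}" by (auto simp: A_def)
  then have fin: "finite A" using finite_subset by blast
  have "i \<in> A" using i by (simp add: A_def)
  then have "Max A \<in> A" using Max_in[OF fin] by blast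
  then have "F (Max A) \<noteq> \<zero>" unfolding A_def by blast
  moreover have "F k = \<zero>" if "Max A < k" for k
  proof (rule ccontr)
    assume "F k \<noteq> \<zero>"
    then have "k \<in> A" using that Max_ge[OF fin \<open>i \<in> A\<close>] by (simp add: A_def)
    then show False using that Max_ge[OF fin, of k] by simp
  qed
  ultimately show ?thesis
    using assms(1) by (intro that[of "Max A"]) (simp_all add: laurent_lead_def)
qed

text \<open>The top coefficient of \<open>F\<close> times \<open>s\<close> is a coefficient of the
  product with \<open>S\<close>; regularity of \<open>s\<close> keeps it from vanishing.\<close>

lemma regular_laurent:
  assumes "laurent_lead S e s" "s \<in> regular_elems R"
  shows "S \<in> regular_elems L"
proof -
  have "F = \<zero>\<^bsub>L\<^esub>" if F: "F \<in> carrier L" "F \<otimes>\<^bsub>L\<^esub> S = \<zero>\<^bsub>L\<^esub>" for F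
  proof (rule ccontr)
    assume "F \<noteq> \<zero>\<^bsub>L\<^esub>"
    with F(1) obtain d where d: "laurent_lead F d (F d)" "F d \<noteq> \<zero>" by (rule laurent_lead_exists)
    have "F d \<otimes> s = \<zero>"
      using laurent_lead_mult[OF d(1) assms(1)] F(2) by (simp add: laurent_lead_def laurent_ring_simps(3))
    then show False
      using assms(2) d laurent_carrier_coeff[OF F(1)] by (auto simp: regular_elems_def)
  qed
  then show ?thesis using assms(1) by (auto simp: regular_elems_def laurent_lead_def)
qed

text \<open>For m > 0 this is the geometric series of the terms x^j q^(-m j) with j \<ge> 0.\<close>

definition laurent_geom :: "'a \<Rightarrow> int \<Rightarrow> int \<Rightarrow> 'a" where
  "laurent_geom x m = (\<lambda>k. if k \<le> 0 \<and> m dvd k then x [^] nat (- k div m) else \<zero>)"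

lemma laurent_lead_geom:
  assumes "x \<in> carrier R" shows "laurent_lead (laurent_geom x m) 0 \<one>"
proof -
  have "laurent_geom x m k = \<zero>" if "k > 0" for k
    using that by (simp add: laurent_geom_def)
  moreover have "laurent_geom x m k \<in> carrier R" for k
    using assms by (simp add: laurent_geom_def)
  moreover have "laurent_geom x m 0 = \<one>"
    by (simp add: laurent_geom_def)
  ultimately show ?thesis
    unfolding laurent_lead_def laurent_ring_simps by blast
qed

text \<open>For \<open>m = 0\<close> the monomial meets the constant term and the two merge. In the
  other cases the exponents are distinct and the larger one leads.\<close>

lemma laurent_lead_one_minus_monom:
  assumes "x \<in> carrier R" "m \<ge> 0"
  shows "laurent_lead (\<one>\<^bsub>L\<^esub> \<ominus>\<^bsub>L\<^esub> laurent_monom R x m) m (if m = 0 then \<one> \<ominus> x else \<ominus> x)"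
    and "m > 0 \<Longrightarrow> laurent_lead (\<one>\<^bsub>L\<^esub> \<ominus>\<^bsub>L\<^esub> laurent_monom R x (- m)) 0 \<one>"
proof -
  interpret L: cring L by (rule cring_laurent_ring)
  have "\<one>\<^bsub>L\<^esub> \<ominus>\<^bsub>L\<^esub> laurent_monom R x k
      = (\<lambda>i. (if i = 0 then \<one> else \<zero>) \<ominus> (if i = k then x else \<zero>))" for k
    using assms(1) by (simp add: laurent_minus) (simp add: laurent_ring_simps laurent_monom_def)
  then have coeff: "(\<one>\<^bsub>L\<^esub> \<ominus>\<^bsub>L\<^esub> laurent_monom R x k) i
      = (if i = 0 then \<one> else \<zero>) \<ominus> (if i = k then x else \<zero>)" for i k
    by (rule fun_cong)
  have closed: "\<one>\<^bsub>L\<^esub> \<ominus>\<^bsub>L\<^esub> laurent_monom R x k \<in> carrier L" for k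
    using assms(1) by simp
  have zero: "\<zero> \<ominus> \<zero> = \<zero>" "\<zero> \<ominus> x = \<ominus> x" "\<one> \<ominus> \<zero> = \<one>"
    using assms(1) by (simp_all add: a_minus_def)
  show "laurent_lead (\<one>\<^bsub>L\<^esub> \<ominus>\<^bsub>L\<^esub> laurent_monom R x m) m (if m = 0 then \<one> \<ominus> x else \<ominus> x)"
    unfolding laurent_lead_def using assms(2) by (intro conjI closed allI impI) (simp_all add: coeff zero)
  show "laurent_lead (\<one>\<^bsub>L\<^esub> \<ominus>\<^bsub>L\<^esub> laurent_monom R x (- m)) 0 \<one>" if "m > 0"
    unfolding laurent_lead_def using that by (intro conjI closed allI impI) (simp_all add: coeff zero)
qed

lemma laurent_geom_inverse:
  assumes "x \<in> carrier R" "m > 0"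
  shows "(\<one>\<^bsub>L\<^esub> \<ominus>\<^bsub>L\<^esub> laurent_monom R x (- m)) \<otimes>\<^bsub>L\<^esub> laurent_geom x m = \<one>\<^bsub>L\<^esub>"
proof -
  interpret L: cring L by (rule cring_laurent_ring)
  let ?g = "laurent_geom x m"
  have g: "?g \<in> carrier L" using laurent_lead_geom[OF assms(1)] by (simp add: laurent_lead_def)
  have "(\<one>\<^bsub>L\<^esub> \<ominus>\<^bsub>L\<^esub> laurent_monom R x (- m)) \<otimes>\<^bsub>L\<^esub> ?g = ?g \<ominus>\<^bsub>L\<^esub> laurent_monom R x (- m) \<otimes>\<^bsub>L\<^esub> ?g"
    using assms(1) g laurent_monom_closed[OF assms(1), of "-m"] by algebra
  also have "\<dots> = (\<lambda>k. ?g k \<ominus> x \<otimes> ?g (k + m))"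
    using assms g laurent_mult_closed[OF laurent_monom_closed[OF assms(1), of "- m"] g]
    by (subst laurent_minus) (simp_all add: laurent_monom_mult)
  also have "\<dots> = \<one>\<^bsub>L\<^esub>"
  proof
    fix k
    show "?g k \<ominus> x \<otimes> ?g (k + m) = \<one>\<^bsub>L\<^esub> k"
    \<comment> \<open>Neighbouring terms cancel at the negative multiples of m. Elsewhere the
      shifted term is zero, because k + m is positive or not divisible by m; at k = 0 this leaves
      the coefficient 1.\<close>
    proof (cases "k < 0 \<and> m dvd k")
      case True
      then obtain j where k: "k = m * j" by auto
      then have "j < 0" using True assms(2) by (simp add: mult_less_0_iff)
      define i where "i = nat (- j - 1)"
      have "nat (- j) = Suc i" "nat (- (j + 1)) = i" using \<open>j < 0\<close> by (simp_all add: i_def)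
      moreover have km: "k + m = m * (j + 1)"
        using k by (simp add: distrib_left)
      moreover have "- k = m * - j" "- (k + m) = m * - (j + 1)"
        by (simp add: k) (simp only: km mult_minus_right)
      then have "- k div m = - j" "- (k + m) div m = - (j + 1)"
        using assms(2) by (simp_all only: nonzero_mult_div_cancel_left)
      moreover have "k + m \<le> 0"
        unfolding km using \<open>j < 0\<close> assms(2) by (simp add: mult_le_0_iff)
      ultimately have gs: "?g k = x [^] Suc i" "?g (k + m) = x [^] i"
        using True by (simp_all add: laurent_geom_def)
      show ?thesis
        unfolding gs using True assms(1)
        by (simp add: laurent_ring_simps laurent_monom_def m_comm r_neg a_minus_def)
    next
      case False
      have "?g (k + m) = \<zero>"
        using False assms(2) by (auto simp: laurent_geom_def)
      moreover have "?g k = \<one>\<^bsub>L\<^esub> k"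
        using False by (auto simp: laurent_geom_def laurent_ring_simps laurent_monom_def)
      moreover have "\<one>\<^bsub>L\<^esub> k \<in> carrier R"
        by (simp add: laurent_carrier_coeff)
      ultimately show ?thesis
        using assms(1) by (simp add: a_minus_def)
    qed
  qed
  finally show ?thesis .
qed

end

section \<open>Total rings of fractions\<close>

context cring
begin

lemma regular_in_carrier: "s \<in> regular_elems R \<Longrightarrow> s \<in> carrier R"
  by (simp add: regular_elems_def)

lemma regular_cancel:
  assumes "s \<in> regular_elems R" "a \<in> carrier R" "b \<in> carrier R" "a \<otimes> s = b \<otimes> s"
  shows "a = b"
proof -
  have s: "s \<in> carrier R" using assms(1) by (rule regular_in_carrier)
  have "(a \<ominus> b) \<otimes> s = a \<otimes> s \<ominus> b \<otimes> s" using assms(2,3) s by algebra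
  then have "(a \<ominus> b) \<otimes> s = \<zero>" using assms s by (simp add: a_minus_def r_neg)
  then have "a \<ominus> b = \<zero>" using assms by (simp add: regular_elems_def)
  moreover have "a = (a \<ominus> b) \<oplus> b" using assms(2,3) by algebra
  ultimately show ?thesis using assms(3) by simp
qed

lemma regular_mult:
  assumes "s \<in> regular_elems R" "t \<in> regular_elems R"
  shows "s \<otimes> t \<in> regular_elems R"
proof -
  have c: "s \<in> carrier R" "t \<in> carrier R" using assms by (simp_all add: regular_in_carrier)
  have "a = \<zero>" if a: "a \<in> carrier R" "a \<otimes> (s \<otimes> t) = \<zero>" for a
  proof -
    have "a \<otimes> s \<otimes> t = \<zero>" using a c by (simp add: m_assoc)
    then have "a \<otimes> s = \<zero>" using a c assms(2) by (simp add: regular_elems_def)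
    then show ?thesis using a assms(1) by (simp add: regular_elems_def)
  qed
  then show ?thesis using c by (simp add: regular_elems_def)
qed

lemma regular_Units:
  assumes "u \<in> Units R" shows "u \<in> regular_elems R"
proof -
  have "a = \<zero>" if "a \<in> carrier R" "a \<otimes> u = \<zero>" for a
    using that assms m_assoc[of a u "inv u", symmetric] Units_closed[OF assms] by simp
  then show ?thesis using assms by (auto simp: regular_elems_def)
qed

lemma regular_one: "\<one> \<in> regular_elems R"
  by (rule regular_Units) simp

text \<open>Transitivity is the point that needs regular denominators: the chain of equalities
  proves the claim only after multiplication by \<open>s\<close>, which is then cancelled.\<close>

lemma frac_class_eq_iff:
  assumes "a \<in> carrier R" "s \<in> regular_elems R" "b \<in> carrier R" "t \<in> regular_elems R"
  shows "frac_class R a s = frac_class R b t \<longleftrightarrow> a \<otimes> t = b \<otimes> s"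
proof
  assume "frac_class R a s = frac_class R b t"
  moreover have "(a, s) \<in> frac_class R a s" using assms by (simp add: frac_class_def)
  ultimately show "a \<otimes> t = b \<otimes> s" by (simp add: frac_class_def)
next
  have sub: "frac_class R a s \<subseteq> frac_class R b t"
    if "a \<otimes> t = b \<otimes> s" "a \<in> carrier R" "s \<in> regular_elems R" "b \<in> carrier R" "t \<in> regular_elems R"
    for a s b t
  proof (clarsimp simp: frac_class_def)
    fix c u assume c: "c \<in> carrier R" "u \<in> regular_elems R" "a \<otimes> u = c \<otimes> s"
    have car: "a \<in> carrier R" "b \<in> carrier R" "c \<in> carrier R"
        "s \<in> carrier R" "t \<in> carrier R" "u \<in> carrier R"
      using that c by (simp_all add: regular_in_carrier)
    have "b \<otimes> u \<otimes> s = b \<otimes> s \<otimes> u" using car by algebra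
    also have "\<dots> = a \<otimes> t \<otimes> u" by (simp only: that(1))
    also have "\<dots> = a \<otimes> u \<otimes> t" using car by algebra
    also have "\<dots> = c \<otimes> s \<otimes> t" by (simp only: c(3))
    also have "\<dots> = c \<otimes> t \<otimes> s" using car by algebra
    finally have "b \<otimes> u \<otimes> s = c \<otimes> t \<otimes> s" .
    from this show "b \<otimes> u = c \<otimes> t"
      by (rule regular_cancel[OF that(3) m_closed m_closed, rotated -1]) (simp_all only: car)
  qed
  assume "a \<otimes> t = b \<otimes> s"
  then show "frac_class R a s = frac_class R b t"
    using assms by (intro equalityI sub) auto
qed

lemma frac_class_cases:
  assumes "X \<in> carrier (total_frac R)"
  obtains a s where "a \<in> carrier R" "s \<in> regular_elems R" "X = frac_class R a s"
  using assms by (auto simp: total_frac_def)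

lemma frac_class_closed:
  "a \<in> carrier R \<Longrightarrow> s \<in> regular_elems R \<Longrightarrow> frac_class R a s \<in> carrier (total_frac R)"
  by (auto simp: total_frac_def)

text \<open>The operations of \<open>total_frac\<close> are unions over all representatives. Classes
  are nonempty, so if every choice gives the same set, the union is that set.\<close>

lemma UN_frac_class_eq:
  assumes "a \<in> carrier R" "s \<in> regular_elems R" "b \<in> carrier R" "t \<in> regular_elems R"
    and "\<And>a' s' b' t'. a' \<in> carrier R \<Longrightarrow> s' \<in> regular_elems R \<Longrightarrow> b' \<in> carrier R \<Longrightarrow>
      t' \<in> regular_elems R \<Longrightarrow> a \<otimes> s' = a' \<otimes> s \<Longrightarrow> b \<otimes> t' = b' \<otimes> t \<Longrightarrow> f a' s' b' t' = Z"
  shows "(\<Union>(a', s')\<in>frac_class R a s. \<Union>(b', t')\<in>frac_class R b t. f a' s' b' t') = Z"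
proof -
  have "(a, s) \<in> frac_class R a s" "(b, t) \<in> frac_class R b t"
    using assms by (simp_all add: frac_class_def)
  moreover have "f a' s' b' t' = Z"
    if "(a', s') \<in> frac_class R a s" "(b', t') \<in> frac_class R b t" for a' s' b' t'
    using that by (intro assms(5)) (simp_all add: frac_class_def)
  ultimately show ?thesis by fastforce
qed

lemma total_frac_mult:
  assumes as: "a \<in> carrier R" "s \<in> regular_elems R" and bt: "b \<in> carrier R" "t \<in> regular_elems R"
  shows "frac_class R a s \<otimes>\<^bsub>total_frac R\<^esub> frac_class R b t = frac_class R (a \<otimes> b) (s \<otimes> t)"
  unfolding total_frac_def monoid.simps
proof (rule UN_frac_class_eq[OF as bt])
  fix a' s' b' t'
  assume *: "a' \<in> carrier R" "s' \<in> regular_elems R" "b' \<in> carrier R" "t' \<in> regular_elems R"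
    and eq: "a \<otimes> s' = a' \<otimes> s" "b \<otimes> t' = b' \<otimes> t"
  note c = regular_in_carrier[OF as(2)] regular_in_carrier[OF bt(2)]
    regular_in_carrier[OF *(2)] regular_in_carrier[OF *(4)]
  have "a' \<otimes> b' \<otimes> (s \<otimes> t) = (a' \<otimes> s) \<otimes> (b' \<otimes> t)" using as bt * c by algebra
  also have "\<dots> = (a \<otimes> s') \<otimes> (b \<otimes> t')" by (simp only: eq)
  also have "\<dots> = a \<otimes> b \<otimes> (s' \<otimes> t')" using as bt * c by algebra
  finally show "frac_class R (a' \<otimes> b') (s' \<otimes> t') = frac_class R (a \<otimes> b) (s \<otimes> t)"
    using as bt * by (subst frac_class_eq_iff) (auto simp: regular_mult)
qed

lemma total_frac_add:
  assumes as: "a \<in> carrier R" "s \<in> regular_elems R" and bt: "b \<in> carrier R" "t \<in> regular_elems R"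
  shows "frac_class R a s \<oplus>\<^bsub>total_frac R\<^esub> frac_class R b t
      = frac_class R (a \<otimes> t \<oplus> b \<otimes> s) (s \<otimes> t)"
  unfolding total_frac_def ring.simps
proof (rule UN_frac_class_eq[OF as bt])
  fix a' s' b' t'
  assume *: "a' \<in> carrier R" "s' \<in> regular_elems R" "b' \<in> carrier R" "t' \<in> regular_elems R"
    and eq: "a \<otimes> s' = a' \<otimes> s" "b \<otimes> t' = b' \<otimes> t"
  note c = regular_in_carrier[OF as(2)] regular_in_carrier[OF bt(2)]
    regular_in_carrier[OF *(2)] regular_in_carrier[OF *(4)]
  have "(a' \<otimes> t' \<oplus> b' \<otimes> s') \<otimes> (s \<otimes> t) = (a' \<otimes> s) \<otimes> (t \<otimes> t') \<oplus> (b' \<otimes> t) \<otimes> (s \<otimes> s')"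
    using as bt * c by algebra
  also have "\<dots> = (a \<otimes> s') \<otimes> (t \<otimes> t') \<oplus> (b \<otimes> t') \<otimes> (s \<otimes> s')" by (simp only: eq)
  also have "\<dots> = (a \<otimes> t \<oplus> b \<otimes> s) \<otimes> (s' \<otimes> t')" using as bt * c by algebra
  finally show "frac_class R (a' \<otimes> t' \<oplus> b' \<otimes> s') (s' \<otimes> t')
      = frac_class R (a \<otimes> t \<oplus> b \<otimes> s) (s \<otimes> t)"
    using as bt * c by (subst frac_class_eq_iff) (auto simp: regular_mult)
qed

lemma total_frac_one_zero:
  "\<one>\<^bsub>total_frac R\<^esub> = frac_class R \<one> \<one>" "\<zero>\<^bsub>total_frac R\<^esub> = frac_class R \<zero> \<one>"
  by (simp_all add: total_frac_def)

lemma cring_total_frac: "cring (total_frac R)"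
proof (rule cringI)
  let ?K = "total_frac R"
  note simps = total_frac_mult total_frac_add total_frac_one_zero regular_in_carrier regular_mult
    regular_one frac_class_eq_iff
  show "abelian_group ?K"
  proof (rule abelian_groupI)
    fix X Y assume "X \<in> carrier ?K" "Y \<in> carrier ?K"
    then show "X \<oplus>\<^bsub>?K\<^esub> Y \<in> carrier ?K"
      by (elim frac_class_cases) (simp add: simps frac_class_closed)
  next
    show "\<zero>\<^bsub>?K\<^esub> \<in> carrier ?K" by (simp add: simps frac_class_closed)
  next
    fix X Y Z assume "X \<in> carrier ?K" "Y \<in> carrier ?K" "Z \<in> carrier ?K"
    then show "X \<oplus>\<^bsub>?K\<^esub> Y \<oplus>\<^bsub>?K\<^esub> Z = X \<oplus>\<^bsub>?K\<^esub> (Y \<oplus>\<^bsub>?K\<^esub> Z)"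
    proof (elim frac_class_cases)
      fix a s b t c u
      assume *: "a \<in> carrier R" "s \<in> regular_elems R" "b \<in> carrier R" "t \<in> regular_elems R"
        "c \<in> carrier R" "u \<in> regular_elems R"
        and [simp]: "X = frac_class R a s" "Y = frac_class R b t" "Z = frac_class R c u"
      note r = *(2,4,6)[THEN regular_in_carrier]
      have "((a \<otimes> t \<oplus> b \<otimes> s) \<otimes> u \<oplus> c \<otimes> (s \<otimes> t)) \<otimes> (s \<otimes> (t \<otimes> u))
          = (a \<otimes> (t \<otimes> u) \<oplus> (b \<otimes> u \<oplus> c \<otimes> t) \<otimes> s) \<otimes> (s \<otimes> t \<otimes> u)"
        using * r by algebra
      then show ?thesis using * by (simp add: simps)
    qed
  next
    fix X Y assume "X \<in> carrier ?K" "Y \<in> carrier ?K"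
    then show "X \<oplus>\<^bsub>?K\<^esub> Y = Y \<oplus>\<^bsub>?K\<^esub> X"
      by (elim frac_class_cases) (simp add: simps m_comm a_comm)
  next
    fix X assume "X \<in> carrier ?K"
    then show "\<zero>\<^bsub>?K\<^esub> \<oplus>\<^bsub>?K\<^esub> X = X"
      by (elim frac_class_cases) (simp add: simps)
  next
    fix X assume "X \<in> carrier ?K"
    then show "\<exists>Y\<in>carrier ?K. Y \<oplus>\<^bsub>?K\<^esub> X = \<zero>\<^bsub>?K\<^esub>"
    proof (elim frac_class_cases)
      fix a s assume *: "a \<in> carrier R" "s \<in> regular_elems R" "X = frac_class R a s"
      then show ?thesis
        by (intro bexI[of _ "frac_class R (\<ominus> a) s"])
          (simp_all add: simps frac_class_closed l_minus l_neg)
    qed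
  qed
  show "Group.comm_monoid ?K"
  proof (rule comm_monoidI)
    fix X Y assume "X \<in> carrier ?K" "Y \<in> carrier ?K"
    then show "X \<otimes>\<^bsub>?K\<^esub> Y \<in> carrier ?K"
      by (elim frac_class_cases) (simp add: simps frac_class_closed)
  next
    show "\<one>\<^bsub>?K\<^esub> \<in> carrier ?K" by (simp add: simps frac_class_closed)
  next
    fix X Y Z assume "X \<in> carrier ?K" "Y \<in> carrier ?K" "Z \<in> carrier ?K"
    then show "X \<otimes>\<^bsub>?K\<^esub> Y \<otimes>\<^bsub>?K\<^esub> Z = X \<otimes>\<^bsub>?K\<^esub> (Y \<otimes>\<^bsub>?K\<^esub> Z)"
      by (elim frac_class_cases) (simp add: simps m_assoc)
  next
    fix X Y assume "X \<in> carrier ?K" "Y \<in> carrier ?K"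
    then show "X \<otimes>\<^bsub>?K\<^esub> Y = Y \<otimes>\<^bsub>?K\<^esub> X"
      by (elim frac_class_cases) (simp add: simps m_comm)
  next
    fix X assume "X \<in> carrier ?K"
    then show "\<one>\<^bsub>?K\<^esub> \<otimes>\<^bsub>?K\<^esub> X = X"
      by (elim frac_class_cases) (simp add: simps)
  qed
  fix X Y Z assume "X \<in> carrier ?K" "Y \<in> carrier ?K" "Z \<in> carrier ?K"
  then show "(X \<oplus>\<^bsub>?K\<^esub> Y) \<otimes>\<^bsub>?K\<^esub> Z = X \<otimes>\<^bsub>?K\<^esub> Z \<oplus>\<^bsub>?K\<^esub> Y \<otimes>\<^bsub>?K\<^esub> Z"
  proof (elim frac_class_cases)
    fix a s b t c u
    assume *: "a \<in> carrier R" "s \<in> regular_elems R" "b \<in> carrier R" "t \<in> regular_elems R"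
      "c \<in> carrier R" "u \<in> regular_elems R"
      and [simp]: "X = frac_class R a s" "Y = frac_class R b t" "Z = frac_class R c u"
    note r = *(2,4,6)[THEN regular_in_carrier]
    have "((a \<otimes> t \<oplus> b \<otimes> s) \<otimes> c) \<otimes> (s \<otimes> u \<otimes> (t \<otimes> u))
        = (a \<otimes> c \<otimes> (t \<otimes> u) \<oplus> b \<otimes> c \<otimes> (s \<otimes> u)) \<otimes> (s \<otimes> t \<otimes> u)"
      using * r by algebra
    then show ?thesis using * by (simp add: simps)
  qed
qed

lemma frac_embed_ring_hom: "ring_hom_cring R (total_frac R) (frac_embed R)"
  by (intro ring_hom_cring.intro ring_hom_cring_axioms.intro ring_hom_memI cring_total_frac is_cring)
    (simp_all add: frac_embed_def total_frac_mult total_frac_add total_frac_one_zero regular_one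
      frac_class_closed)

lemma frac_embed_inject:
  "a \<in> carrier R \<Longrightarrow> b \<in> carrier R \<Longrightarrow> frac_embed R a = frac_embed R b \<longleftrightarrow> a = b"
  by (simp add: frac_embed_def frac_class_eq_iff regular_one)

lemma frac_embed_regular_Units:
  assumes "s \<in> regular_elems R"
  shows "frac_embed R s \<in> Units (total_frac R)"
proof -
  interpret K: cring "total_frac R" by (rule cring_total_frac)
  have s: "s \<in> carrier R" using assms by (rule regular_in_carrier)
  have "frac_class R s \<one> \<otimes>\<^bsub>total_frac R\<^esub> frac_class R \<one> s = \<one>\<^bsub>total_frac R\<^esub>"
    using assms s by (simp add: total_frac_mult total_frac_one_zero regular_one frac_class_eq_iff)
  moreover have "frac_class R s \<one> \<in> carrier (total_frac R)" "frac_class R \<one> s \<in> carrier (total_frac R)"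
    using assms s by (simp_all add: frac_class_closed regular_one)
  ultimately show ?thesis
    using K.m_comm unfolding frac_embed_def Units_def by force
qed

end

section \<open>Leading terms of fractions of Laurent series\<close>

lemma (in comm_monoid) finprod_Units:
  assumes "\<And>i. i \<in> A \<Longrightarrow> f i \<in> Units G"
  shows "finprod G f A \<in> Units G" "inv (finprod G f A) = (\<Otimes>i\<in>A. inv (f i))"
proof -
  have c: "f \<in> A \<rightarrow> carrier G" "(\<lambda>i. inv (f i)) \<in> A \<rightarrow> carrier G"
    using assms by auto
  have "finprod G f A \<otimes> (\<Otimes>i\<in>A. inv (f i)) = (\<Otimes>i\<in>A. f i \<otimes> inv (f i))"
    using c by (rule finprod_multf[symmetric])
  also have "\<dots> = \<one>" using assms by (intro finprod_one_eqI) simp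
  finally have *: "finprod G f A \<otimes> (\<Otimes>i\<in>A. inv (f i)) = \<one>" .
  note closed = finprod_closed[OF c(1)] finprod_closed[OF c(2)]
  show "inv (finprod G f A) = (\<Otimes>i\<in>A. inv (f i))"
    by (rule comm_inv_char[OF closed *])
  show "finprod G f A \<in> Units G"
    using * m_comm[OF closed] closed unfolding Units_def by auto
qed

lemma (in comm_monoid) inv_mult_Units:
  assumes "x \<in> Units G" "y \<in> Units G"
  shows "inv (x \<otimes> y) = inv x \<otimes> inv y"
proof (rule comm_inv_char)
  have "x \<otimes> y \<otimes> (inv x \<otimes> inv y) = (x \<otimes> inv x) \<otimes> (y \<otimes> inv y)"
    using assms Units_closed Units_inv_closed by (simp only: m_ac m_closed)
  then show "x \<otimes> y \<otimes> (inv x \<otimes> inv y) = \<one>" using assms by simp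
qed (use assms in auto)

context cring
begin

abbreviation (input) "K \<equiv> total_frac (laurent_ring R)"

abbreviation (input) "emb \<equiv> frac_embed (laurent_ring R)"

text \<open>Besides a leading term this asserts that \<open>y\<close> is a Laurent series. It is
  therefore applied to inverses of \<open>c_fun\<close>, since \<open>c_fun\<close> itself may
  contain constant denominators without an inverse series.\<close>

definition frac_lead :: "((int \<Rightarrow> 'a) \<times> (int \<Rightarrow> 'a)) set \<Rightarrow> int \<Rightarrow> 'a \<Rightarrow> bool" where
  "frac_lead y d a \<longleftrightarrow> (\<exists>F. laurent_lead F d a \<and> y = emb F)"

lemma cring_laurent_frac: "cring K"
  by (rule cring.cring_total_frac[OF cring_laurent_ring])

lemma laurent_embed_ring_hom: "ring_hom_cring L K emb"
  by (rule cring.frac_embed_ring_hom[OF cring_laurent_ring])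

lemma frac_lead_closed: "frac_lead y d a \<Longrightarrow> y \<in> carrier K" "frac_lead y d a \<Longrightarrow> a \<in> carrier R"
proof -
  interpret E: ring_hom_cring L K emb by (rule laurent_embed_ring_hom)
  show "frac_lead y d a \<Longrightarrow> y \<in> carrier K" by (auto simp: frac_lead_def laurent_lead_def)
  show "frac_lead y d a \<Longrightarrow> a \<in> carrier R"
    by (auto simp: frac_lead_def laurent_lead_def laurent_carrier_coeff)
qed

lemma frac_lead_mult:
  assumes "frac_lead y d a" "frac_lead z e b"
  shows "frac_lead (y \<otimes>\<^bsub>K\<^esub> z) (d + e) (a \<otimes> b)"
proof -
  interpret E: ring_hom_cring L K emb by (rule laurent_embed_ring_hom)
  obtain F G where *: "laurent_lead F d a" "y = emb F" "laurent_lead G e b" "z = emb G"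
    using assms by (auto simp: frac_lead_def)
  moreover have "F \<in> carrier L" "G \<in> carrier L"
    using * by (simp_all add: laurent_lead_def)
  ultimately show ?thesis
    unfolding frac_lead_def by (intro exI[of _ "F \<otimes>\<^bsub>L\<^esub> G"]) (simp add: laurent_lead_mult)
qed

lemma frac_lead_one: "frac_lead \<one>\<^bsub>K\<^esub> 0 \<one>"
proof -
  interpret E: ring_hom_cring L K emb by (rule laurent_embed_ring_hom)
  show ?thesis using laurent_lead_one E.hom_one unfolding frac_lead_def by metis
qed

lemma frac_lead_finprod:
  assumes "finite A" "\<And>i. i \<in> A \<Longrightarrow> frac_lead (f i) (d i) (a i)"
  shows "frac_lead (finprod K f A) (sum d A) (finprod R a A)"
proof -
  interpret K: cring K by (rule cring_laurent_frac)
  show ?thesis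
    using assms
  proof (induction A rule: finite_induct)
    case empty
    show ?case by (simp add: frac_lead_one)
  next
    case (insert i A)
    then have "f j \<in> carrier K" "a j \<in> carrier R" if "j \<in> insert i A" for j
      using that frac_lead_closed by blast+
    then have "finprod K f (insert i A) = f i \<otimes>\<^bsub>K\<^esub> finprod K f A"
      "finprod R a (insert i A) = a i \<otimes> finprod R a A"
      using insert.hyps by (auto intro!: K.finprod_insert finprod_insert)
    then show ?case
      using insert by (simp add: frac_lead_mult)
  qed
qed

lemma frac_lead_pow:
  "frac_lead y 0 \<one> \<Longrightarrow> frac_lead (y [^]\<^bsub>K\<^esub> (n::nat)) 0 \<one>"
proof (induction n)
  case 0
  show ?case by (simp add: frac_lead_one)
next
  case (Suc n)
  then show ?case using frac_lead_mult[of _ 0 \<one> y 0 \<one>] by simp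
qed

lemma frac_lead_monom: "a \<in> carrier R \<Longrightarrow> frac_lead (emb (laurent_monom R a d)) d a"
  using laurent_lead_monom unfolding frac_lead_def by blast

lemma emb_monom_mult:
  assumes "a \<in> carrier R" "b \<in> carrier R"
  shows "emb (laurent_monom R a d) \<otimes>\<^bsub>K\<^esub> emb (laurent_monom R b e)
    = emb (laurent_monom R (a \<otimes> b) (d + e))"
proof -
  interpret E: ring_hom_cring L K emb by (rule laurent_embed_ring_hom)
  show ?thesis using assms by (simp add: laurent_monom_mult_monom flip: E.hom_mult)
qed

lemma emb_monom_inv:
  assumes "a \<in> carrier R" "b \<in> carrier R" "a \<otimes> b = \<one>"
  shows "inv\<^bsub>K\<^esub> (emb (laurent_monom R a d)) = emb (laurent_monom R b (- d))"
proof -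
  interpret K: cring K by (rule cring_laurent_frac)
  interpret E: ring_hom_cring L K emb by (rule laurent_embed_ring_hom)
  have "emb (laurent_monom R \<one> 0) = \<one>\<^bsub>K\<^esub>"
    using E.hom_one by (simp only: laurent_ring_simps(2))
  then show ?thesis
    using assms by (intro K.comm_inv_char) (simp_all add: emb_monom_mult)
qed

lemma emb_monom_nat_pow:
  assumes "u \<in> carrier R"
  shows "emb (laurent_monom R u d) [^]\<^bsub>K\<^esub> (n::nat) = emb (laurent_monom R (u [^] n) (d * int n))"
proof (induction n)
  case 0
  interpret E: ring_hom_cring L K emb by (rule laurent_embed_ring_hom)
  show ?case using E.hom_one by (simp add: laurent_ring_simps(2))
next
  case (Suc n)
  interpret K: cring K by (rule cring_laurent_frac)
  show ?case using assms Suc by (simp add: emb_monom_mult algebra_simps)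
qed

text \<open>An element with u^2 = 1 is its own inverse, so the exponent \<bar>e\<bar> serves both
  signs of \<open>e\<close>. The instances are u = 1 for powers of q and u = -1 for powers of
  v.\<close>

lemma emb_monom_int_pow:
  assumes "u \<in> carrier R" "u \<otimes> u = \<one>"
  shows "emb (laurent_monom R u d) [^]\<^bsub>K\<^esub> (e::int)
    = emb (laurent_monom R (u [^] nat \<bar>e\<bar>) (d * e))"
proof (cases "e < 0")
  case True
  have "u [^] k \<otimes> u [^] k = \<one>" for k :: nat
    using assms by (simp flip: nat_pow_distrib)
  then show ?thesis
    using True assms(1) by (simp add: int_pow_def2 emb_monom_nat_pow
        emb_monom_inv[of "u [^] nat (- e)" "u [^] nat (- e)"] del: pow_nat)
next
  case False
  then show ?thesis using assms(1) by (simp add: int_pow_def2 emb_monom_nat_pow del: pow_nat)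
qed

lemma one_minus_emb_monom:
  assumes "x \<in> carrier R"
  shows "\<one>\<^bsub>K\<^esub> \<ominus>\<^bsub>K\<^esub> emb (laurent_monom R x k) = emb (\<one>\<^bsub>L\<^esub> \<ominus>\<^bsub>L\<^esub> laurent_monom R x k)"
proof -
  interpret E: ring_hom_cring L K emb by (rule laurent_embed_ring_hom)
  show ?thesis using assms by (simp add: a_minus_def)
qed

text \<open>The geometric series is already an inverse in the ring of Laurent series, so the inverse
  in \<open>K\<close> is a series with leading term 1.\<close>

lemma frac_lead_one_minus_neg:
  assumes "x \<in> carrier R" "m < 0"
  defines "N \<equiv> \<one>\<^bsub>K\<^esub> \<ominus>\<^bsub>K\<^esub> emb (laurent_monom R x m)"
  shows "frac_lead N 0 \<one>" "N \<in> Units K" "frac_lead (inv\<^bsub>K\<^esub> N) 0 \<one>"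
proof -
  interpret K: cring K by (rule cring_laurent_frac)
  interpret E: ring_hom_cring L K emb by (rule laurent_embed_ring_hom)
  let ?N = "\<one>\<^bsub>L\<^esub> \<ominus>\<^bsub>L\<^esub> laurent_monom R x m" and ?G = "laurent_geom x (- m)"
  have N: "N = emb ?N" unfolding N_def by (rule one_minus_emb_monom) fact
  have lead: "laurent_lead ?N 0 \<one>" "laurent_lead ?G 0 \<one>"
    using laurent_lead_one_minus_monom(2)[of x "- m"] laurent_lead_geom assms(1,2) by simp_all
  then have closed: "?N \<in> carrier L" "?G \<in> carrier L"
    by (simp_all only: laurent_lead_def)
  have "?N \<otimes>\<^bsub>L\<^esub> ?G = \<one>\<^bsub>L\<^esub>" using laurent_geom_inverse[of x "- m"] assms by simp
  then have "N \<otimes>\<^bsub>K\<^esub> emb ?G = \<one>\<^bsub>K\<^esub>"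
    using E.hom_mult[OF closed] E.hom_one N by simp
  moreover have "N \<in> carrier K" "emb ?G \<in> carrier K" using closed N E.hom_closed by auto
  ultimately have inv: "inv\<^bsub>K\<^esub> N = emb ?G" and "N \<in> Units K"
    using K.comm_inv_char[of N "emb ?G"] K.m_comm[of N "emb ?G"] unfolding Units_def by auto
  then show "frac_lead N 0 \<one>" "N \<in> Units K" "frac_lead (inv\<^bsub>K\<^esub> N) 0 \<one>"
    using lead unfolding inv unfolding frac_lead_def N by auto
qed

text \<open>A regular leading coefficient yields an inverse in \<open>K\<close> but no series for
  it. The element itself, rather than its inverse, is what appears in the inverse of
  \<open>c_fun\<close>.\<close>

lemma frac_lead_one_minus_nonneg:
  assumes "x \<in> carrier R" "m \<ge> 0"
  defines "N \<equiv> \<one>\<^bsub>K\<^esub> \<ominus>\<^bsub>K\<^esub> emb (laurent_monom R x m)"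
    and "a \<equiv> (if m = 0 then \<one> \<ominus> x else \<ominus> x)"
  assumes "a \<in> regular_elems R"
  shows "frac_lead N m a" "N \<in> Units K"
proof -
  interpret L: cring L by (rule cring_laurent_ring)
  let ?N = "\<one>\<^bsub>L\<^esub> \<ominus>\<^bsub>L\<^esub> laurent_monom R x m"
  have N: "N = emb ?N" unfolding N_def by (rule one_minus_emb_monom) fact
  have lead: "laurent_lead ?N m a"
    unfolding a_def using assms(1,2) by (rule laurent_lead_one_minus_monom)
  then show "frac_lead N m a" unfolding frac_lead_def N by blast
  show "N \<in> Units K"
    unfolding N using regular_laurent[OF lead assms(5)] by (rule L.frac_embed_regular_Units)
qed

section \<open>Leading terms of the factors and products in the quotient\<close>

lemma neg_one_pow_square: "(\<ominus> \<one>) [^] (k::nat) \<otimes> (\<ominus> \<one>) [^] k = \<one>"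
proof -
  have "\<ominus> \<one> \<otimes> \<ominus> \<one> = \<one>" by (simp add: l_minus)
  then show ?thesis by (simp flip: nat_pow_distrib)
qed

text \<open>Only the explicit powers of q carry degree: the differences 1 - q^(-2 m) with m > 0 have
  leading term 1, and this survives powers and inversion.\<close>

lemma frac_lead_C_fun:
  assumes "\<forall>x\<in>set lam. 0 < x"
  shows "frac_lead (C_fun K (emb (laurent_q R)) n lam)
     (- (int n * (int n + 1)) + (\<Sum>i<length lam. (int (lam ! i))\<^sup>2 - int (lam ! i))) \<one>"
proof -
  interpret K: cring K by (rule cring_laurent_frac)
  let ?q = "emb (laurent_q R)"
  have q: "?q [^]\<^bsub>K\<^esub> e = emb (laurent_monom R \<one> e)" for e :: int
    by (simp add: laurent_q_eq_monom emb_monom_int_pow)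
  have factor: "frac_lead (?q [^]\<^bsub>K\<^esub> ((int m)\<^sup>2 - int m)
      \<otimes>\<^bsub>K\<^esub> (\<one>\<^bsub>K\<^esub> \<ominus>\<^bsub>K\<^esub> ?q [^]\<^bsub>K\<^esub> (- 2 :: int)) [^]\<^bsub>K\<^esub> m
      \<otimes>\<^bsub>K\<^esub> inv\<^bsub>K\<^esub> (\<one>\<^bsub>K\<^esub> \<ominus>\<^bsub>K\<^esub> ?q [^]\<^bsub>K\<^esub> (- 2 * int m))) ((int m)\<^sup>2 - int m) \<one>" if "m > 0" for m
    using frac_lead_mult[OF frac_lead_mult[OF
          frac_lead_monom[OF one_closed]
          frac_lead_pow[OF frac_lead_one_minus_neg(1)[OF one_closed, of "- 2"]]]
          frac_lead_one_minus_neg(3)[OF one_closed, of "- 2 * int m"],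
          of "(int m)\<^sup>2 - int m" m] that
    by (simp add: q)
  have "frac_lead (C_fun K ?q n lam)
     (- (int n * (int n + 1)) + (\<Sum>i<length lam. (int (lam ! i))\<^sup>2 - int (lam ! i)))
     (\<one> \<otimes> (\<Otimes>i\<in>{..<length lam}. \<one>))"
    unfolding C_fun_def
    by (intro frac_lead_mult frac_lead_finprod factor)
      (use assms in \<open>auto simp: q intro: frac_lead_monom\<close>)
  then show ?thesis by simp
qed

text \<open>The leading coefficient of 1 - v^(-m) x for m \<ge> 0. Since the inverse of v is -q, the
  subtracted term is (-1)^m x q^m.\<close>

definition c_coeff :: "int \<Rightarrow> 'a \<Rightarrow> 'a" where
  "c_coeff m x = (if m = 0 then \<one> \<ominus> x else \<ominus> ((\<ominus> \<one>) [^] nat m \<otimes> x))"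

text \<open>The numerator of a factor has a positive exponent of v, hence leading term 1 together
  with its inverse. Degree and coefficient of the inverted factor thus come from the denominator
  alone.\<close>

lemma frac_lead_c_factor:
  assumes a: "a \<in> Units R" and b: "b \<in> Units R" and e: "(e::int) > 0" and m: "m \<ge> 0"
    and reg: "m = 0 \<Longrightarrow> \<one> \<ominus> inv a \<otimes> b \<in> regular_elems R"
  defines "z \<equiv> (\<lambda>a. emb (laurent_const R a))" and "v \<equiv> \<ominus>\<^bsub>K\<^esub> (inv\<^bsub>K\<^esub> (emb (laurent_q R)))"
  defines "f \<equiv> (\<one>\<^bsub>K\<^esub> \<ominus>\<^bsub>K\<^esub> v [^]\<^bsub>K\<^esub> e \<otimes>\<^bsub>K\<^esub> inv\<^bsub>K\<^esub> (z a) \<otimes>\<^bsub>K\<^esub> z b)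
    \<otimes>\<^bsub>K\<^esub> inv\<^bsub>K\<^esub> (\<one>\<^bsub>K\<^esub> \<ominus>\<^bsub>K\<^esub> v [^]\<^bsub>K\<^esub> (- m) \<otimes>\<^bsub>K\<^esub> inv\<^bsub>K\<^esub> (z a) \<otimes>\<^bsub>K\<^esub> z b)"
  shows "f \<in> Units K" "frac_lead (inv\<^bsub>K\<^esub> f) m (c_coeff m (inv a \<otimes> b))"
proof -
  interpret L: cring L by (rule cring_laurent_ring)
  interpret K: cring K by (rule cring_laurent_frac)
  interpret E: ring_hom_cring L K emb by (rule laurent_embed_ring_hom)
  have ab: "a \<in> carrier R" "inv a \<in> carrier R" "b \<in> carrier R" "inv a \<otimes> b \<in> Units R"
    using a b by auto
  define s where "s = (\<lambda>k::int. (\<ominus> \<one>) [^] nat \<bar>k\<bar>)"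
  have s: "s k \<in> carrier R" for k unfolding s_def by (rule nat_pow_closed) simp
  have "\<ominus>\<^bsub>L\<^esub> laurent_monom R \<one> (- 1) = laurent_monom R (\<ominus> \<one>) (- 1)"
    by (simp add: laurent_uminus) (auto simp: laurent_monom_def)
  then have v: "v = emb (laurent_monom R (\<ominus> \<one>) (- 1))"
    using E.hom_a_inv[of "laurent_monom R \<one> (- 1)"]
    by (simp add: v_def laurent_q_eq_monom emb_monom_inv[of \<one> \<one>])
  have vzz: "v [^]\<^bsub>K\<^esub> k \<otimes>\<^bsub>K\<^esub> inv\<^bsub>K\<^esub> (z a) \<otimes>\<^bsub>K\<^esub> z b
      = emb (laurent_monom R (s k \<otimes> (inv a \<otimes> b)) (- k))" for k :: int
    using ab a s[of k]
    by (simp add: v z_def laurent_const_eq_monom emb_monom_int_pow l_minus emb_monom_inv[of a "inv a"]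
        emb_monom_mult s_def m_assoc del: pow_nat)
  have unit: "s k \<otimes> (inv a \<otimes> b) \<in> Units R" for k
  proof -
    have "s k \<in> Units R"
      using s[of k] neg_one_pow_square[of "nat \<bar>k\<bar>"] unfolding Units_def s_def by blast
    then show ?thesis using ab by simp
  qed
  let ?N = "\<one>\<^bsub>K\<^esub> \<ominus>\<^bsub>K\<^esub> emb (laurent_monom R (s e \<otimes> (inv a \<otimes> b)) (- e))"
  let ?D = "\<one>\<^bsub>K\<^esub> \<ominus>\<^bsub>K\<^esub> emb (laurent_monom R (s (- m) \<otimes> (inv a \<otimes> b)) m)"
  have N: "?N \<in> Units K" "frac_lead (inv\<^bsub>K\<^esub> ?N) 0 \<one>"
    using frac_lead_one_minus_neg[of "s e \<otimes> (inv a \<otimes> b)" "- e"] unit e by auto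
  have c: "c_coeff m (inv a \<otimes> b) = (if m = 0 then \<one> \<ominus> s (- m) \<otimes> (inv a \<otimes> b) else \<ominus> (s (- m) \<otimes> (inv a \<otimes> b)))"
    using m ab by (simp add: c_coeff_def s_def del: pow_nat)
  have c_reg: "c_coeff m (inv a \<otimes> b) \<in> regular_elems R"
  proof (cases "m = 0")
    case True
    then show ?thesis using reg by (simp add: c_coeff_def)
  next
    case False
    have "\<ominus> (s (- m) \<otimes> (inv a \<otimes> b)) = \<ominus> \<one> \<otimes> (s (- m) \<otimes> (inv a \<otimes> b))"
      using Units_closed[OF unit] by (simp add: l_minus)
    moreover have "\<ominus> \<one> \<otimes> (s (- m) \<otimes> (inv a \<otimes> b)) \<in> Units R"
      using Units_minus_one_closed unit by (rule Units_m_closed)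
    ultimately show ?thesis using False c by (simp add: regular_Units)
  qed
  have D: "?D \<in> Units K" "frac_lead ?D m (c_coeff m (inv a \<otimes> b))"
    using frac_lead_one_minus_nonneg[OF Units_closed[OF unit] m c_reg[unfolded c]]
    by (simp_all only: c)
  have f: "f = ?N \<otimes>\<^bsub>K\<^esub> inv\<^bsub>K\<^esub> ?D" by (simp add: f_def vzz)
  show "f \<in> Units K" unfolding f using N(1) D(1) by (intro K.Units_m_closed K.Units_inv_Units)
  have "inv\<^bsub>K\<^esub> f = inv\<^bsub>K\<^esub> ?N \<otimes>\<^bsub>K\<^esub> ?D"
    unfolding f using N(1) D(1) by (simp add: K.inv_mult_Units)
  then show "frac_lead (inv\<^bsub>K\<^esub> f) m (c_coeff m (inv a \<otimes> b))"
    using frac_lead_mult[OF N(2) D(2)] frac_lead_closed(2)[OF D(2)] by simp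
qed

end

lemma finite_c_index:
  fixes lam :: "nat list"
  shows "finite {(i, j, k). i < j \<and> j < length lam \<and> 1 \<le> k \<and> k \<le> lam ! j}"
proof (rule finite_subset)
  show "{(i, j, k). i < j \<and> j < length lam \<and> 1 \<le> k \<and> k \<le> lam ! j}
      \<subseteq> {..<length lam} \<times> {..<length lam} \<times> {..sum_list lam}"
    using elem_le_sum_list[of _ lam] by (fastforce intro: order.trans)
qed simp

context cring
begin

lemma c_coeff_closed: "x \<in> carrier R \<Longrightarrow> c_coeff m x \<in> carrier R"
  by (simp add: c_coeff_def del: pow_nat)

text \<open>For m > 0 both coefficients carry the same sign, which squares to 1, and
  \<open>x\<close> cancels against its inverse. This is why the two copies of \<open>c_fun\<close>
  are evaluated together.\<close>

lemma c_coeff_mult_inv: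
  assumes "x \<in> Units R" "m \<ge> 0"
  shows "c_coeff m x \<otimes> c_coeff m (inv x) = (if m = 0 then (\<one> \<ominus> x) \<otimes> (\<one> \<ominus> inv x) else \<one>)"
proof (cases "m = 0")
  case False
  define s where "s = (\<ominus> \<one>) [^] nat m"
  have s: "s \<in> carrier R" "s \<otimes> s = \<one>" using neg_one_pow_square by (simp_all add: s_def del: pow_nat)
  have x: "x \<in> carrier R" "inv x \<in> carrier R" using assms(1) by auto
  have "\<ominus> (s \<otimes> x) \<otimes> \<ominus> (s \<otimes> inv x) = (s \<otimes> s) \<otimes> (x \<otimes> inv x)"
    using s(1) x by algebra
  also have "\<dots> = \<one>" using s assms(1) by simp
  finally show ?thesis using False by (simp add: c_coeff_def s_def)
qed (simp add: c_coeff_def)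

lemma frac_lead_c_fun:
  assumes sorted: "\<And>i j. i < j \<Longrightarrow> j < length lam \<Longrightarrow> lam ! j \<le> lam ! i"
    and w: "\<And>i. i < length lam \<Longrightarrow> w i \<in> Units R"
    and z: "\<And>i. i < length lam \<Longrightarrow> z i = emb (laurent_const R (w i))"
    and reg: "\<And>i j. i < j \<Longrightarrow> j < length lam \<Longrightarrow> lam ! i = lam ! j \<Longrightarrow>
      \<one> \<ominus> inv (w i) \<otimes> w j \<in> regular_elems R"
  defines "c \<equiv> c_fun K (\<ominus>\<^bsub>K\<^esub> (inv\<^bsub>K\<^esub> (emb (laurent_q R)))) z lam"
    and "T \<equiv> {(i, j, k). i < j \<and> j < length lam \<and> 1 \<le> k \<and> k \<le> lam ! j}"
  shows "c \<in> Units K"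
    "frac_lead (inv\<^bsub>K\<^esub> c) (\<Sum>(i, j, k)\<in>T. int (lam ! i) + int (lam ! j) - 2 * int k)
      (finprod R (\<lambda>(i, j, k). c_coeff (int (lam ! i) + int (lam ! j) - 2 * int k) (inv (w i) \<otimes> w j)) T)"
proof -
  interpret K: cring K by (rule cring_laurent_frac)
  let ?v = "\<ominus>\<^bsub>K\<^esub> (inv\<^bsub>K\<^esub> (emb (laurent_q R)))"
  define f where "f = (\<lambda>(i, j, k).
        (\<one>\<^bsub>K\<^esub> \<ominus>\<^bsub>K\<^esub> ?v [^]\<^bsub>K\<^esub> (int (lam ! i) - int (lam ! j) + 2 * int k)
             \<otimes>\<^bsub>K\<^esub> inv\<^bsub>K\<^esub> (z i) \<otimes>\<^bsub>K\<^esub> z j)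
          \<otimes>\<^bsub>K\<^esub> inv\<^bsub>K\<^esub> (\<one>\<^bsub>K\<^esub> \<ominus>\<^bsub>K\<^esub> ?v [^]\<^bsub>K\<^esub> (- int (lam ! i) - int (lam ! j) + 2 * int k)
             \<otimes>\<^bsub>K\<^esub> inv\<^bsub>K\<^esub> (z i) \<otimes>\<^bsub>K\<^esub> z j))"
  have c: "c = finprod K f T" by (simp add: c_def c_fun_def f_def T_def)
  have factor: "f (i, j, k) \<in> Units K"
    "frac_lead (inv\<^bsub>K\<^esub> (f (i, j, k))) (int (lam ! i) + int (lam ! j) - 2 * int k)
        (c_coeff (int (lam ! i) + int (lam ! j) - 2 * int k) (inv (w i) \<otimes> w j))"
    if "(i, j, k) \<in> T" for i j k
  proof -
    have ij: "i < j" "i < length lam" "j < length lam" "1 \<le> k" "k \<le> lam ! j" "lam ! j \<le> lam ! i"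
      using that sorted by (auto simp: T_def)
    have m: "- int (lam ! i) - int (lam ! j) + 2 * int k = - (int (lam ! i) + int (lam ! j) - 2 * int k)"
      by simp
    \<comment> \<open>The exponent is the sum of the nonnegative numbers \<open>lam ! i - k\<close>
      and \<open>lam ! j - k\<close>, so it is zero only if both are.\<close>
    have "lam ! i = lam ! j" if "int (lam ! i) + int (lam ! j) - 2 * int k = 0"
      using ij that by linarith
    then show "f (i, j, k) \<in> Units K"
      "frac_lead (inv\<^bsub>K\<^esub> (f (i, j, k))) (int (lam ! i) + int (lam ! j) - 2 * int k)
        (c_coeff (int (lam ! i) + int (lam ! j) - 2 * int k) (inv (w i) \<otimes> w j))"
      unfolding f_def prod.case z[OF ij(2)] z[OF ij(3)] m
      using ij by (intro frac_lead_c_factor w reg; simp)+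
  qed
  have T: "finite T" unfolding T_def by (rule finite_c_index)
  have units: "t \<in> T \<Longrightarrow> f t \<in> Units K" for t using factor(1) by (cases t) auto
  show "c \<in> Units K" unfolding c using units by (rule K.finprod_Units)
  have inv: "inv\<^bsub>K\<^esub> c = finprod K (\<lambda>t. inv\<^bsub>K\<^esub> (f t)) T" unfolding c using units by (rule K.finprod_Units)
  show "frac_lead (inv\<^bsub>K\<^esub> c) (\<Sum>(i, j, k)\<in>T. int (lam ! i) + int (lam ! j) - 2 * int k)
      (finprod R (\<lambda>(i, j, k). c_coeff (int (lam ! i) + int (lam ! j) - 2 * int k) (inv (w i) \<otimes> w j)) T)"
    unfolding inv using T
  proof (rule frac_lead_finprod)
    fix t assume "t \<in> T"
    then show "frac_lead (inv\<^bsub>K\<^esub> (f t))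
        (case t of (i, j, k) \<Rightarrow> int (lam ! i) + int (lam ! j) - 2 * int k)
        (case t of (i, j, k) \<Rightarrow>
          c_coeff (int (lam ! i) + int (lam ! j) - 2 * int k) (inv (w i) \<otimes> w j))"
      using factor(2) by (cases t) auto
  qed
qed

lemma frac_lead_C_quotient:
  assumes pos: "\<forall>x\<in>set lam. 0 < x"
    and sorted: "\<And>i j. i < j \<Longrightarrow> j < length lam \<Longrightarrow> lam ! j \<le> lam ! i"
    and w: "\<And>i. i < length lam \<Longrightarrow> w i \<in> Units R"
    and reg: "\<And>i j. i < length lam \<Longrightarrow> j < length lam \<Longrightarrow> i \<noteq> j \<Longrightarrow>
      \<one> \<ominus> inv (w i) \<otimes> w j \<in> regular_elems R"
  defines "q \<equiv> emb (laurent_q R)" and "z \<equiv> (\<lambda>i. emb (laurent_const R (w i)))"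
  defines "v \<equiv> \<ominus>\<^bsub>K\<^esub> (inv\<^bsub>K\<^esub> q)"
  defines "T \<equiv> {(i, j, k). i < j \<and> j < length lam \<and> 1 \<le> k \<and> k \<le> lam ! j}"
  shows "frac_lead (C_fun K q n lam \<otimes>\<^bsub>K\<^esub> inv\<^bsub>K\<^esub> (c_fun K v z lam \<otimes>\<^bsub>K\<^esub> c_fun K v (\<lambda>i. inv\<^bsub>K\<^esub> (z i)) lam))
    (- (int n * (int n + 1)) + (\<Sum>i<length lam. (int (lam ! i))\<^sup>2 - int (lam ! i))
      + 2 * (\<Sum>(i, j, k)\<in>T. int (lam ! i) + int (lam ! j) - 2 * int k))
    (finprod R (\<lambda>(i, j). \<one> \<ominus> w i \<otimes> inv (w j))
      {(i, j). i < length lam \<and> j < length lam \<and> i \<noteq> j \<and> lam ! i = lam ! j})"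
    (is "frac_lead ?x ?d ?a")
proof -
  interpret K: cring K by (rule cring_laurent_frac)
  define m where "m = (\<lambda>(i, j, k). int (lam ! i) + int (lam ! j) - 2 * int k)"
  define x where "x = (\<lambda>(i, j, k :: nat). inv (w i) \<otimes> w j)"
  have T: "finite T" unfolding T_def by (rule finite_c_index)
  have w_closed: "w i \<in> carrier R" "inv (w i) \<in> carrier R" if "i < length lam" for i
    using w[OF that] by auto
  have pos_nth: "1 \<le> lam ! j" if "j < length lam" for j
    using pos nth_mem[OF that] by (simp add: Suc_le_eq)
  have idx: "i < j" "i < length lam" "j < length lam" "1 \<le> k" "k \<le> lam ! j" "lam ! j \<le> lam ! i"
    if "(i, j, k) \<in> T" for i j k
    using that sorted by (auto simp: T_def)
  have x: "x t \<in> Units R" if "t \<in> T" for t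
    using that idx w by (cases t) (auto simp: x_def)
  have inv_x: "inv (x t) = (case t of (i, j, k) \<Rightarrow> w i \<otimes> inv (w j))" if "t \<in> T" for t
    using that idx w by (cases t) (auto simp: x_def inv_mult_Units)
  have x_closed: "x t \<in> carrier R" "inv (x t) \<in> carrier R" if "t \<in> T" for t
    using x[OF that] by auto
  have inv_z: "inv\<^bsub>K\<^esub> (z i) = emb (laurent_const R (inv (w i)))" if "i < length lam" for i
    using w[OF that] w_closed[OF that] by (simp add: z_def laurent_const_eq_monom emb_monom_inv[of _ "inv (w i)"])
  \<comment> \<open>Inverting all \<open>w i\<close> exchanges the roles of the two rows, so the
    hypothesis applies to the pair (j, i).\<close>
  have reg': "\<one> \<ominus> inv (inv (w i)) \<otimes> inv (w j) \<in> regular_elems R"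
    if "i < j" "j < length lam" "lam ! i = lam ! j" for i j
    using reg[of j i] that w[of i] w[of j] by (simp add: m_comm w_closed)
  have c1: "c_fun K v z lam \<in> Units K"
    "frac_lead (inv\<^bsub>K\<^esub> (c_fun K v z lam)) (sum m T) (\<Otimes>t\<in>T. c_coeff (m t) (x t))"
    using frac_lead_c_fun[of lam w z] sorted w reg
    by (simp_all add: z_def v_def q_def T_def m_def x_def case_prod_beta')
  have c2: "c_fun K v (\<lambda>i. inv\<^bsub>K\<^esub> (z i)) lam \<in> Units K"
    "frac_lead (inv\<^bsub>K\<^esub> (c_fun K v (\<lambda>i. inv\<^bsub>K\<^esub> (z i)) lam)) (sum m T) (\<Otimes>t\<in>T. c_coeff (m t) (inv (x t)))"
  proof -
    note * = frac_lead_c_fun[of lam "\<lambda>i. inv (w i)" "\<lambda>i. inv\<^bsub>K\<^esub> (z i)", OF sorted Units_inv_Units[OF w] inv_z reg']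
    show "c_fun K v (\<lambda>i. inv\<^bsub>K\<^esub> (z i)) lam \<in> Units K"
      unfolding v_def q_def by (rule *(1))
    have eq: "(\<Otimes>t\<in>T. c_coeff (m t) (inv (x t))) = finprod R (\<lambda>(i, j, k).
        c_coeff (int (lam ! i) + int (lam ! j) - 2 * int k) (inv (inv (w i)) \<otimes> inv (w j))) T"
    proof (rule finprod_cong')
      fix t assume t: "t \<in> T"
      then show "c_coeff (m t) (inv (x t)) = (case t of (i, j, k) \<Rightarrow>
          c_coeff (int (lam ! i) + int (lam ! j) - 2 * int k) (inv (inv (w i)) \<otimes> inv (w j)))"
        unfolding inv_x[OF t] using idx w by (cases t) (simp add: m_def)
    qed (use idx w_closed w in \<open>auto intro!: c_coeff_closed\<close>)
    show "frac_lead (inv\<^bsub>K\<^esub> (c_fun K v (\<lambda>i. inv\<^bsub>K\<^esub> (z i)) lam)) (sum m T) (\<Otimes>t\<in>T. c_coeff (m t) (inv (x t)))"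
      unfolding v_def q_def eq unfolding m_def T_def by (rule *(2))
  qed
  \<comment> \<open>Each pair i < j of equal parts supplies two factors, one for each order of the
    rows. Together with its image under \<open>prod.swap\<close>, \<open>?D\<close> gives the
    ordered pairs in the claim.\<close>
  let ?D = "{(i, j). i < j \<and> j < length lam \<and> lam ! i = lam ! j}"
  let ?g = "\<lambda>(i, j). \<one> \<ominus> w i \<otimes> inv (w j)"
  have D: "finite ?D"
    by (rule finite_subset[of _ "{..<length lam} \<times> {..<length lam}"]) auto
  have g_closed: "?g \<in> ?D \<rightarrow> carrier R" "(\<lambda>p. ?g (prod.swap p)) \<in> ?D \<rightarrow> carrier R"
    by (auto simp: w_closed)
  have "(\<Otimes>t\<in>T. c_coeff (m t) (x t)) \<otimes> (\<Otimes>t\<in>T. c_coeff (m t) (inv (x t)))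
      = (\<Otimes>t\<in>T. c_coeff (m t) (x t) \<otimes> c_coeff (m t) (inv (x t)))"
    using x_closed by (intro finprod_multf[symmetric]) (auto intro!: c_coeff_closed)
  also have "\<dots> = (\<Otimes>t\<in>T. if m t = 0 then (\<one> \<ominus> x t) \<otimes> (\<one> \<ominus> inv (x t)) else \<one>)"
  proof (rule finprod_cong')
    fix t assume t: "t \<in> T"
    then obtain i j k where "t = (i, j, k)" by (cases t)
    then have "m t \<ge> 0" using idx[of i j k] t by (simp add: m_def)
    then show "c_coeff (m t) (x t) \<otimes> c_coeff (m t) (inv (x t))
        = (if m t = 0 then (\<one> \<ominus> x t) \<otimes> (\<one> \<ominus> inv (x t)) else \<one>)"
      by (rule c_coeff_mult_inv[OF x[OF t]])
  qed (auto simp: x_closed)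
  \<comment> \<open>For a pair of equal parts the exponent is zero at exactly one index, k =
    \<open>lam ! j\<close>; for unequal parts it never is. All other factors are 1.\<close>
  also have "\<dots> = (\<Otimes>t\<in>(\<lambda>(i, j). (i, j, lam ! j)) ` ?D. (\<one> \<ominus> x t) \<otimes> (\<one> \<ominus> inv (x t)))"
  proof (rule finprod_mono_neutral_cong_right[OF T])
    show sub: "(\<lambda>(i, j). (i, j, lam ! j)) ` ?D \<subseteq> T"
      using pos_nth by (auto simp: T_def)
    show "(if m t = 0 then (\<one> \<ominus> x t) \<otimes> (\<one> \<ominus> inv (x t)) else \<one>) = \<one>"
      if "t \<in> T - (\<lambda>(i, j). (i, j, lam ! j)) ` ?D" for t
    proof -
      obtain i j k where t: "t = (i, j, k)" by (cases t)
      have "m t \<noteq> 0"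
      proof
        assume "m t = 0"
        then have "k = lam ! j" "lam ! i = lam ! j" "i < j" "j < length lam"
          using idx[of i j k] that unfolding m_def t by auto
        then have "t \<in> (\<lambda>(i, j). (i, j, lam ! j)) ` ?D" unfolding t by force
        then show False using that by blast
      qed
      then show ?thesis by simp
    qed
    show "(if m t = 0 then (\<one> \<ominus> x t) \<otimes> (\<one> \<ominus> inv (x t)) else \<one>) = (\<one> \<ominus> x t) \<otimes> (\<one> \<ominus> inv (x t))"
      if "t \<in> (\<lambda>(i, j). (i, j, lam ! j)) ` ?D" for t
      using that by (auto simp: m_def)
  qed (auto simp: x_closed)
  also have "\<dots> = (\<Otimes>p\<in>?D. ?g (prod.swap p) \<otimes> ?g p)"
  proof -
    let ?h = "\<lambda>(i, j). (i, j, lam ! j)"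
    have hT: "?h p \<in> T" if "p \<in> ?D" for p using pos_nth that by (auto simp: T_def)
    have "(\<Otimes>t\<in>?h ` ?D. (\<one> \<ominus> x t) \<otimes> (\<one> \<ominus> inv (x t)))
        = (\<Otimes>p\<in>?D. (\<one> \<ominus> x (?h p)) \<otimes> (\<one> \<ominus> inv (x (?h p))))"
      using hT x_closed by (intro finprod_reindex) (auto simp: inj_on_def)
    also have "\<dots> = (\<Otimes>p\<in>?D. ?g (prod.swap p) \<otimes> ?g p)"
    proof (rule finprod_cong')
      fix p assume p: "p \<in> ?D"
      then obtain i j where ij: "p = (i, j)" "i < length lam" "j < length lam" by auto
      show "(\<one> \<ominus> x (?h p)) \<otimes> (\<one> \<ominus> inv (x (?h p))) = ?g (prod.swap p) \<otimes> ?g p"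
        unfolding inv_x[OF hT[OF p]] using ij w_closed by (simp add: x_def m_comm)
    qed (auto simp: w_closed)
    finally show ?thesis .
  qed
  also have "\<dots> = (\<Otimes>p\<in>?D. ?g (prod.swap p)) \<otimes> (\<Otimes>p\<in>?D. ?g p)"
    using g_closed(2,1) by (rule finprod_multf)
  also have "(\<Otimes>p\<in>?D. ?g (prod.swap p)) = (\<Otimes>p\<in>prod.swap ` ?D. ?g p)"
    by (intro finprod_reindex[symmetric]) (auto simp: inj_on_def w_closed)
  also have "(\<Otimes>p\<in>prod.swap ` ?D. ?g p) \<otimes> (\<Otimes>p\<in>?D. ?g p) = (\<Otimes>p\<in>prod.swap ` ?D \<union> ?D. ?g p)"
    using D by (intro finprod_Un_disjoint[symmetric]) (auto simp: w_closed)
  also have "prod.swap ` ?D \<union> ?D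
      = {(i, j). i < length lam \<and> j < length lam \<and> i \<noteq> j \<and> lam ! i = lam ! j}"
    by (auto simp: image_iff)
  finally have a: "(\<Otimes>t\<in>T. c_coeff (m t) (x t)) \<otimes> (\<Otimes>t\<in>T. c_coeff (m t) (inv (x t))) = ?a" .
  have "frac_lead ?x (- (int n * (int n + 1)) + (\<Sum>i<length lam. (int (lam ! i))\<^sup>2 - int (lam ! i))
      + (sum m T + sum m T))
     (\<one> \<otimes> ((\<Otimes>t\<in>T. c_coeff (m t) (x t)) \<otimes> (\<Otimes>t\<in>T. c_coeff (m t) (inv (x t)))))"
    unfolding K.inv_mult_Units[OF c1(1) c2(1)] q_def
    by (intro frac_lead_mult c1(2) c2(2) frac_lead_C_fun pos)
  moreover have "?a \<in> carrier R" by (intro finprod_closed) (auto simp: w_closed)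
  ultimately show ?thesis
    unfolding a by (simp add: m_def)
qed

end

section \<open>Lengths of longest elements of Young subgroups\<close>

definition inversions :: "nat \<Rightarrow> (nat \<Rightarrow> nat) \<Rightarrow> (nat \<times> nat) set" where
  "inversions N w = {(a, b). a \<in> {1..N} \<and> b \<in> {1..N} \<and> a < b \<and> w b < w a}"

lemma finite_inversions: "finite (inversions N w)"
  by (rule finite_subset[of _ "{1..N} \<times> {1..N}"]) (auto simp: inversions_def)

text \<open>No integer lies strictly between \<open>i\<close> and \<open>Suc i\<close>, so
  exchanging the two moves neither of them past a third.\<close>

lemma transpose_Suc_less_iff:
  assumes "x \<noteq> y" "{x, y} \<noteq> {i, Suc i}"
  shows "Transposition.transpose i (Suc i) x < Transposition.transpose i (Suc i) y \<longleftrightarrow> x < y"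
  using assms by (auto simp: Transposition.transpose_def)

text \<open>Composition on the left acts on values. Only the two positions that carry
  \<open>i\<close> and \<open>Suc i\<close> change their relative order, and by assumption they
  begin in increasing order.\<close>

lemma inversions_transpose:
  assumes w: "w permutes {1..N}" and i: "i \<in> {1..<N}" and lt: "inv_into UNIV w i < inv_into UNIV w (Suc i)"
  defines "s \<equiv> Transposition.transpose i (Suc i)"
  shows "inversions N (s \<circ> w) = insert (inv_into UNIV w i, inv_into UNIV w (Suc i)) (inversions N w)"
    and "(inv_into UNIV w i, inv_into UNIV w (Suc i)) \<notin> inversions N w"
proof -
  define p p' where "p = inv_into UNIV w i" and "p' = inv_into UNIV w (Suc i)"
  have wp: "w p = i" "w p' = Suc i" using w by (simp_all add: p_def p'_def permutes_inverses)
  have mem: "p \<in> {1..N}" "p' \<in> {1..N}"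
    using permutes_in_image[OF w, of p] permutes_in_image[OF w, of p'] i wp by auto
  have inj: "w a = w b \<longleftrightarrow> a = b" for a b using permutes_inj[OF w] by (simp add: inj_eq)
  have "s (w b) < s (w a) \<longleftrightarrow> (a, b) = (p, p') \<or> w b < w a" if "a < b" for a b
  proof (cases "{w b, w a} = {i, Suc i}")
    case True
    then have "w a = w p \<and> w b = w p' \<or> w a = w p' \<and> w b = w p"
      unfolding wp doubleton_eq_iff by blast
    then have "a = p \<and> b = p' \<or> a = p' \<and> b = p"
      by (simp only: inj)
    then show ?thesis using that lt wp by (auto simp: s_def p_def[symmetric] p'_def[symmetric])
  next
    case False
    have "(a, b) \<noteq> (p, p')" using False wp by auto
    moreover have "w b \<noteq> w a" using inj that by simp
    ultimately show ?thesis using False transpose_Suc_less_iff[of "w b" "w a" i] unfolding s_def by blast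
  qed
  then show "inversions N (s \<circ> w) = insert (inv_into UNIV w i, inv_into UNIV w (Suc i)) (inversions N w)"
    using mem lt unfolding inversions_def p_def[symmetric] p'_def[symmetric] by auto
  show "(inv_into UNIV w i, inv_into UNIV w (Suc i)) \<notin> inversions N w"
    using wp by (simp add: inversions_def p_def[symmetric] p'_def[symmetric])
qed

lemma transpose_comp_permutes:
  assumes "w permutes {1..N}" "i \<in> {1..<N}"
  shows "Transposition.transpose i (Suc i) \<circ> w permutes {1..N}"
  using assms by (intro permutes_compose permutes_swap_id) auto

text \<open>The transposition turns the descent into an ascent of the composite, and applying it
  twice returns to \<open>w\<close>. So the preceding lemma is used for the composite.\<close>

lemma card_inversions_descent:
  assumes w: "w permutes {1..N}" and i: "i \<in> {1..<N}" and gt: "inv_into UNIV w (Suc i) < inv_into UNIV w i"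
  shows "card (inversions N w) = Suc (card (inversions N (Transposition.transpose i (Suc i) \<circ> w)))"
proof -
  define s where "s = Transposition.transpose i (Suc i)"
  have u: "s \<circ> w permutes {1..N}" unfolding s_def using w i by (rule transpose_comp_permutes)
  have su: "s \<circ> (s \<circ> w) = w" by (auto simp: s_def)
  have "bij s" by (simp add: s_def)
  then have "inv_into UNIV (s \<circ> w) = inv_into UNIV w \<circ> s"
    using o_inv_distrib[OF _ permutes_bij[OF w], of s] by (simp add: s_def)
  then have "inv_into UNIV (s \<circ> w) i < inv_into UNIV (s \<circ> w) (Suc i)" using gt by (simp add: s_def)
  from inversions_transpose[OF u i this] su finite_inversions show ?thesis
    unfolding s_def[symmetric] by simp
qed

lemma card_inversions_transpose_le:
  assumes w: "w permutes {1..N}" and i: "i \<in> {1..<N}"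
  shows "card (inversions N (Transposition.transpose i (Suc i) \<circ> w)) \<le> Suc (card (inversions N w))"
proof (cases "inv_into UNIV w i < inv_into UNIV w (Suc i)")
  case True
  show ?thesis
    unfolding inversions_transpose(1)[OF w i True] by (rule card_insert_le_m1[of "Suc _", simplified]) simp
next
  case False
  have "inv_into UNIV w i \<noteq> inv_into UNIV w (Suc i)" using w by (metis n_not_Suc_n permutes_inverses(1))
  then show ?thesis using card_inversions_descent[OF w i] False by simp
qed

text \<open>Without a descent the inverse of \<open>w\<close> increases strictly on
  \<open>{1..N}\<close>, so it sends no point below itself and must be the identity.\<close>

lemma permutes_descent_exists:
  assumes w: "w permutes {1..N}" and "w \<noteq> id"
  obtains i where "i \<in> {1..<N}" "inv_into UNIV w (Suc i) < inv_into UNIV w i"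
proof (rule ccontr)
  assume "\<not> thesis"
  with that have le: "inv_into UNIV w i \<le> inv_into UNIV w (Suc i)" if "i \<in> {1..<N}" for i using \<open>i \<in> _\<close> by force
  have lt: "inv_into UNIV w i < inv_into UNIV w (Suc i)" if "i \<in> {1..<N}" for i
    using le[OF that] w by (metis n_not_Suc_n nat_less_le permutes_inverses(1))
  have w': "inv_into UNIV w permutes {1..N}" using w by (rule permutes_inv)
  have "Suc k \<le> N \<Longrightarrow> Suc k \<le> inv_into UNIV w (Suc k)" for k
  proof (induction k)
    case 0
    then show ?case using permutes_in_image[OF w', of 1] by simp
  next
    case (Suc k)
    then show ?case using lt[of "Suc k"] by simp
  qed
  then have "\<forall>i\<in>{1..N}. i \<le> inv_into UNIV w i" by (metis One_nat_def Suc_le_D atLeastAtMost_iff)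
  then have "inv_into UNIV w = id" by (intro permutes_natset_ge[OF w']) auto
  then have "w = id" using w by (metis inv_id permutes_inv_inv)
  then show False using \<open>w \<noteq> id\<close> by simp
qed

text \<open>Removing one descent at a time produces a word with as many letters as inversions. No
  shorter word exists, because each letter creates at most one inversion.\<close>

lemma perm_length_eq_card_inversions:
  assumes "w permutes {1..N}"
  shows "perm_length N w = card (inversions N w)"
proof -
  define f where "f = (\<lambda>ks. foldr (\<lambda>i u. Transposition.transpose i (Suc i) \<circ> u) ks id)"
  have f: "f [] = id" "f (i # ks) = Transposition.transpose i (Suc i) \<circ> f ks" for i ks
    by (simp_all add: f_def fun_eq_iff)
  have word: "\<exists>ks. length ks = k \<and> set ks \<subseteq> {1..<N} \<and> w = f ks"
    if "card (inversions N w) = k" for k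
    using that assms
  proof (induction k arbitrary: w)
    case 0
    have "w = id"
      using 0 card_inversions_descent by (metis nat.distinct(1) permutes_descent_exists)
    then show ?case by (intro exI[of _ "[]"]) (simp add: f)
  next
    case (Suc k)
    have "inversions N id = {}" by (auto simp: inversions_def)
    then have "w \<noteq> id" using Suc.prems(1) by (metis card.empty nat.distinct(1))
    with Suc.prems(2) obtain i where i: "i \<in> {1..<N}" "inv_into UNIV w (Suc i) < inv_into UNIV w i"
      by (rule permutes_descent_exists)
    let ?u = "Transposition.transpose i (Suc i) \<circ> w"
    have "card (inversions N ?u) = k"
      using card_inversions_descent[OF Suc.prems(2) i] Suc.prems(1) by simp
    then obtain ks where ks: "length ks = k" "set ks \<subseteq> {1..<N}" "?u = f ks"
      using Suc.IH transpose_comp_permutes[OF Suc.prems(2) i(1)] by blast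
    have "w = Transposition.transpose i (Suc i) \<circ> ?u" by (simp add: fun_eq_iff)
    also have "\<dots> = f (i # ks)" unfolding ks(3) f ..
    finally have "w = f (i # ks)" .
    moreover have "length (i # ks) = Suc k" "set (i # ks) \<subseteq> {1..<N}" using ks(1,2) i(1) by auto
    ultimately show ?case by blast
  qed
  have le: "f ks permutes {1..N} \<and> card (inversions N (f ks)) \<le> length ks"
    if "set ks \<subseteq> {1..<N}" for ks
    using that
  proof (induction ks)
    case Nil
    have "inversions N id = {}" by (auto simp: inversions_def)
    then have "card (inversions N id) \<le> length []" by (metis card.empty le0)
    then show ?case unfolding f by (intro conjI permutes_id)
  next
    case (Cons i ks)
    then have IH: "f ks permutes {1..N}" "card (inversions N (f ks)) \<le> length ks" and i: "i \<in> {1..<N}"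
      by auto
    have "Suc (card (inversions N (f ks))) \<le> length (i # ks)" using IH(2) by simp
    with card_inversions_transpose_le[OF IH(1) i]
    have "card (inversions N (f (i # ks))) \<le> length (i # ks)" unfolding f by (rule order.trans)
    then show ?case using transpose_comp_permutes[OF IH(1) i] unfolding f by (intro conjI)
  qed
  have "perm_length N w = (LEAST k. \<exists>ks. length ks = k \<and> set ks \<subseteq> {1..<N} \<and> w = f ks)"
    unfolding perm_length_def f_def ..
  also have "\<dots> = card (inversions N w)"
  proof (rule Least_equality)
    show "\<exists>ks. length ks = card (inversions N w) \<and> set ks \<subseteq> {1..<N} \<and> w = f ks"
      using word[OF refl] .
    show "card (inversions N w) \<le> k"
      if "\<exists>ks. length ks = k \<and> set ks \<subseteq> {1..<N} \<and> w = f ks" for k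
      using that le by blast
  qed
  finally show ?thesis .
qed

section \<open>Young subgroups and the reversal of rows\<close>

context
  fixes mu :: "nat list"
begin

abbreviation (input) "S r \<equiv> sum_list (take r mu)"

lemma partial_sums_mono: "r \<le> r' \<Longrightarrow> S r \<le> S r'"
  by (metis le_add1 le_Suc_ex sum_list_append take_add)

lemma partial_sums_le: "S r \<le> sum_list mu"
  by (metis append_take_drop_id le_add1 sum_list_append)

lemma rows_disjoint:
  assumes "x \<in> row mu r" "x \<in> row mu r'"
  shows "r = r'"
proof (rule ccontr)
  assume "r \<noteq> r'"
  then have "S (Suc r) \<le> S r' \<or> S (Suc r') \<le> S r"
    using partial_sums_mono[of "Suc r" r'] partial_sums_mono[of "Suc r'" r] by linarith
  then show False using assms by (auto simp: row_def)
qed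

lemma rows_cover:
  assumes "x \<in> {1..sum_list mu}"
  obtains r where "r < length mu" "x \<in> row mu r"
proof -
  have "x \<le> S r \<Longrightarrow> \<exists>r'<r. x \<in> row mu r'" for r
  proof (induction r)
    case 0
    then show ?case using assms by simp
  next
    case (Suc r)
    then show ?case
      by (cases "x \<le> S r") (auto simp: row_def intro: less_SucI)
  qed
  from this[of "length mu"] that show ?thesis using assms by auto
qed

lemma row_subset: "row mu r \<subseteq> {1..sum_list mu}"
  using partial_sums_le[of "Suc r"] by (auto simp: row_def)

text \<open>The binomial coefficient m choose 2 is kept as \<open>\<Sum>{..<m}\<close>, with one
  summand per entry of the row, so that \<open>sum_conj_partition\<close> can regroup it.\<close>

lemma card_row_pairs:
  assumes "r < length mu"
  shows "card {(a, b). a \<in> row mu r \<and> b \<in> row mu r \<and> a < b} = \<Sum>{..<mu ! r}"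
proof -
  have S: "S (Suc r) = S r + mu ! r" using assms by (simp add: take_Suc_conv_app_nth)
  \<comment> \<open>Offsets are counted from \<open>Suc (S r)\<close>, the first entry of the row.
    The larger offset comes first, so that it indexes the \<open>SIGMA\<close>.\<close>
  have "bij_betw (\<lambda>(i, j). (Suc (S r + j), Suc (S r + i))) (SIGMA i:{..<mu ! r}. {..<i})
     {(a, b). a \<in> row mu r \<and> b \<in> row mu r \<and> a < b}"
    by (rule bij_betw_byWitness[where f' = "\<lambda>(a, b). (b - Suc (S r), a - Suc (S r))"])
      (auto simp: row_def S)
  from bij_betw_same_card[OF this] show ?thesis by (simp add: card_SigmaI)
qed

lemma card_rows_pairs:
  "card (\<Union>r<length mu. {(a, b). a \<in> row mu r \<and> b \<in> row mu r \<and> a < b})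
    = (\<Sum>r<length mu. \<Sum>{..<mu ! r})"
proof -
  have "finite {(a, b). a \<in> row mu r \<and> b \<in> row mu r \<and> a < b}" for r
    by (rule finite_subset[of _ "row mu r \<times> row mu r"]) (auto simp: row_def)
  then show ?thesis
    by (subst card_UN_disjoint) (use rows_disjoint card_row_pairs in \<open>auto simp: disjoint_iff\<close>)
qed

text \<open>Rows are consecutive blocks, each mapped to itself. Two entries of different rows keep
  their order, since that order is decided by the blocks.\<close>

lemma inversions_young:
  assumes "w \<in> young_subgroup mu"
  shows "inversions (sum_list mu) w
    \<subseteq> (\<Union>r<length mu. {(a, b). a \<in> row mu r \<and> b \<in> row mu r \<and> a < b})"
proof
  fix x assume "x \<in> inversions (sum_list mu) w"
  then obtain a b where x: "x = (a, b)"
    and *: "a \<in> {1..sum_list mu}" "b \<in> {1..sum_list mu}" "a < b" "w b < w a"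
    by (auto simp: inversions_def)
  obtain r where r: "r < length mu" "a \<in> row mu r" using rows_cover[of a] * by auto
  obtain r' where r': "r' < length mu" "b \<in> row mu r'" using rows_cover[of b] * by auto
  have w: "w a \<in> row mu r" "w b \<in> row mu r'"
    using assms r r' by (auto simp: young_subgroup_def)
  have "\<not> r < r'" using partial_sums_mono[of "Suc r" r'] w * by (auto simp: row_def)
  moreover have "\<not> r' < r" using partial_sums_mono[of "Suc r'" r] r r' * by (auto simp: row_def)
  ultimately have "r = r'" by simp
  then show "x \<in> (\<Union>r<length mu. {(a, b). a \<in> row mu r \<and> b \<in> row mu r \<and> a < b})"
    using r r' x \<open>a < b\<close> by auto
qed

lemma row_reversal_exists:
  obtains w where "w \<in> young_subgroup mu"
    "inversions (sum_list mu) w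
      = (\<Union>r<length mu. {(a, b). a \<in> row mu r \<and> b \<in> row mu r \<and> a < b})"
proof -
  \<comment> \<open>Row \<open>r\<close> runs from \<open>S r + 1\<close> to
    \<open>S (Suc r)\<close>; subtracting from the sum of these two ends reflects it.\<close>
  define w where "w = (\<lambda>x. if x \<in> {1..sum_list mu}
    then let r = (THE r. r < length mu \<and> x \<in> row mu r) in S r + S (Suc r) + 1 - x else x)"
  have w: "w x = S r + S (Suc r) + 1 - x" if "r < length mu" "x \<in> row mu r" for r x
  proof -
    have "(THE r. r < length mu \<and> x \<in> row mu r) = r" using that rows_disjoint by blast
    moreover have "x \<in> {1..sum_list mu}" using that row_subset by blast
    ultimately show ?thesis by (simp add: w_def)
  qed
  have w_row: "w x \<in> row mu r" "w (w x) = x" if "r < length mu" "x \<in> row mu r" for r x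
  proof -
    show "w x \<in> row mu r" using that(2) unfolding w[OF that] by (auto simp: row_def)
    from w[OF that(1) this] show "w (w x) = x" using that(2) unfolding w[OF that] by (auto simp: row_def)
  qed
  have ww: "w (w x) = x" for x
  proof (cases "x \<in> {1..sum_list mu}")
    case True
    then show ?thesis using w_row rows_cover by metis
  next
    case False
    then have "w x = x" unfolding w_def by (rule if_not_P)
    then show ?thesis by simp
  qed
  have "w permutes {1..sum_list mu}"
    unfolding permutes_def using ww by (metis w_def)
  moreover have "w ` row mu r = row mu r" if "r < length mu" for r
    using w_row[OF that] by (metis (no_types, lifting) image_subset_iff subsetI subset_antisym image_eqI)
  ultimately have young: "w \<in> young_subgroup mu" by (simp add: young_subgroup_def)
  have "w b < w a" if "r < length mu" "a \<in> row mu r" "b \<in> row mu r" "a < b" for a b r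
    using that w[OF that(1,2)] w[OF that(1,3)] by (auto simp: row_def)
  then have "(\<Union>r<length mu. {(a, b). a \<in> row mu r \<and> b \<in> row mu r \<and> a < b}) \<subseteq> inversions (sum_list mu) w"
    using row_subset unfolding inversions_def by blast
  with inversions_young[OF young] young that show ?thesis by blast
qed

text \<open>\<open>inversions_young\<close> bounds the length of every element and the reversal of
  all rows attains the bound, so whichever maximiser \<open>ARG_MAX\<close> selects has this
  length.\<close>

lemma perm_length_longest_young:
  "perm_length (sum_list mu) (longest_element (sum_list mu) (young_subgroup mu))
    = (\<Sum>r<length mu. \<Sum>{..<mu ! r})"
proof -
  let ?U = "\<Union>r<length mu. {(a, b). a \<in> row mu r \<and> b \<in> row mu r \<and> a < b}"
  obtain w where w: "w \<in> young_subgroup mu" "inversions (sum_list mu) w = ?U"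
    by (rule row_reversal_exists)
  have len: "perm_length (sum_list mu) u = card (inversions (sum_list mu) u)"
    if "u \<in> young_subgroup mu" for u
    using that by (intro perm_length_eq_card_inversions) (simp add: young_subgroup_def)
  have "finite ?U" unfolding w(2)[symmetric] by (rule finite_inversions)
  then have "perm_length (sum_list mu) u \<le> perm_length (sum_list mu) w" if "u \<in> young_subgroup mu" for u
    using len[OF that] len[OF w(1)] inversions_young[OF that] w(2) by (simp add: card_mono)
  then have "perm_length (sum_list mu) (longest_element (sum_list mu) (young_subgroup mu))
      = perm_length (sum_list mu) w"
    unfolding longest_element_def by (rule arg_max_equality[where f = "perm_length (sum_list mu)" and P = "\<lambda>w. w \<in> young_subgroup mu", OF w(1)])
  then show ?thesis using len[OF w(1)] w(2) card_rows_pairs by simp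
qed

end

text \<open>Both sides sum \<open>f\<close> at the row index over all boxes of the diagram, column
  by column on the left and row by row on the right.\<close>

lemma sum_conj_partition:
  fixes f :: "nat \<Rightarrow> nat"
  assumes "sorted_wrt (\<ge>) lam"
  shows "(\<Sum>r<length (conj_partition lam). \<Sum>i<conj_partition lam ! r. f i)
    = (\<Sum>i<length lam. lam ! i * f i)"
proof -
  have anti: "lam ! j \<le> lam ! i" if "i \<le> j" "j < length lam" for i j
    using that assms by (cases "i = j") (auto simp: sorted_wrt_iff_nth_less)
  \<comment> \<open>The parts decrease weakly, so the rows that reach column j are the topmost ones;
    their number determines them.\<close>
  have col: "{..<card {i. i < length lam \<and> j \<le> lam ! i}} = {i. i < length lam \<and> j \<le> lam ! i}" for j
  proof -
    let ?A = "{i. i < length lam \<and> j \<le> lam ! i}"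
    have fin: "finite ?A" by simp
    have down: "i' \<in> ?A" if "i \<in> ?A" "i' \<le> i" for i i' using that anti[of i' i] by auto
    have "?A = {..<card ?A}"
    proof (rule card_subset_eq[symmetric])
      show "{..<card ?A} \<subseteq> ?A"
      proof
        fix i assume "i \<in> {..<card ?A}"
        show "i \<in> ?A"
        proof (rule ccontr)
          assume "i \<notin> ?A"
          then have "?A \<subseteq> {..<i}" using down by (meson lessThan_iff not_le subsetI)
          then have "card ?A \<le> i" using card_mono[of "{..<i}" ?A] by simp
          then show False using \<open>i \<in> {..<card ?A}\<close> by simp
        qed
      qed
    qed (use fin in simp_all)
    then show ?thesis ..
  qed
  have hd: "lam ! i \<le> hd lam" if "i < length lam" for i
    using anti[of 0 i] that by (cases lam) auto
  \<comment> \<open>Entry \<open>r\<close> of the conjugate partition belongs to column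
    \<open>Suc r\<close>, because its list of columns starts at 1.\<close>
  have "(\<Sum>r<length (conj_partition lam). \<Sum>i<conj_partition lam ! r. f i)
      = (\<Sum>r<hd lam. \<Sum>i | i < length lam \<and> Suc r \<le> lam ! i. f i)"
    by (simp add: conj_partition_def col del: upt_Suc)
  also have "\<dots> = (\<Sum>r<hd lam. \<Sum>i<length lam. if r < lam ! i then f i else 0)"
    by (intro sum.cong refl sum.mono_neutral_cong_left) (auto simp: Suc_le_eq)
  also have "\<dots> = (\<Sum>i<length lam. \<Sum>r<hd lam. if r < lam ! i then f i else 0)"
    by (rule sum.swap)
  also have "\<dots> = (\<Sum>i<length lam. \<Sum>r<lam ! i. f i)"
    by (intro sum.cong refl sum.mono_neutral_cong_right) (auto dest: hd intro: order.strict_trans2)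
  finally show ?thesis by simp
qed

text \<open>Two instances of the count by boxes: the constant 1 shows that both partitions have the
  same size, and the row index itself gives the length.\<close>

lemma length_w_conj_eq:
  assumes "sorted_wrt (\<ge>) lam"
  shows "length_w_conj lam = (\<Sum>i<length lam. i * lam ! i)"
proof -
  have "sum_list (conj_partition lam) = sum_list lam"
    using sum_conj_partition[OF assms, of "\<lambda>_. 1"]
    by (simp add: sum_list_sum_nth atLeast0LessThan)
  then show ?thesis
    using perm_length_longest_young[of "conj_partition lam"] sum_conj_partition[OF assms, of "\<lambda>i. i"]
    by (simp add: length_w_conj_def Let_def mult.commute)
qed

section \<open>The total exponent of q\<close>

lemma square_sum_lessThan:
  fixes f :: "nat \<Rightarrow> int"
  shows "(\<Sum>i<m. f i)\<^sup>2 = (\<Sum>i<m. (f i)\<^sup>2) + 2 * (\<Sum>j<m. \<Sum>i<j. f i * f j)"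
  by (induction m) (simp_all add: power2_sum sum_distrib_left sum_distrib_right algebra_simps)

text \<open>A pair i < j contributes the product of its two parts minus part j. The products
  complete the square of n + 1, which cancels the remaining terms; part j is subtracted once for
  each of the j rows before it.\<close>

lemma C_quotient_degree:
  fixes lam :: "nat list"
  assumes "sum_list lam = n + 1"
  shows "- (int n * (int n + 1)) + (\<Sum>i<length lam. (int (lam ! i))\<^sup>2 - int (lam ! i))
      + 2 * (\<Sum>(i, j, k)\<in>{(i, j, k). i < j \<and> j < length lam \<and> 1 \<le> k \<and> k \<le> lam ! j}.
              int (lam ! i) + int (lam ! j) - 2 * int k)
    = - 2 * (\<Sum>i<length lam. int i * int (lam ! i))"
proof -
  let ?l = "\<lambda>i. int (lam ! i)" and ?m = "length lam"
  have "(\<Sum>k=1..b. c - 2 * int k) = c * int b - int b * (int b + 1)" for b c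
    by (induction b) (simp_all add: algebra_simps)
  \<comment> \<open>With c = a + b the closed form c b - b (b + 1) collapses to a b - b.\<close>
  from this[where c = "_ + int _"]
  have inner: "(\<Sum>k=1..b. a + int b - 2 * int k) = a * int b - int b" for a b
    by (simp only:) (simp add: algebra_simps)
  \<comment> \<open>The index j is moved to the front because the ranges of i and k both depend on
    it.\<close>
  have "{(i, j, k). i < j \<and> j < ?m \<and> 1 \<le> k \<and> k \<le> lam ! j}
      = (\<lambda>(j, i, k). (i, j, k)) ` (SIGMA j:{..<?m}. {..<j} \<times> {1..lam ! j})"
    by (auto simp: image_iff)
  then have "(\<Sum>(i, j, k)\<in>{(i, j, k). i < j \<and> j < ?m \<and> 1 \<le> k \<and> k \<le> lam ! j}. ?l i + ?l j - 2 * int k)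
      = (\<Sum>(j, i, k)\<in>(SIGMA j:{..<?m}. {..<j} \<times> {1..lam ! j}). ?l i + ?l j - 2 * int k)"
    by (simp add: sum.reindex inj_on_def case_prod_beta')
  also have "\<dots> = (\<Sum>j<?m. \<Sum>i<j. \<Sum>k\<in>{1..lam ! j}. ?l i + ?l j - 2 * int k)"
    by (subst sum.Sigma[symmetric]) (auto simp: sum.cartesian_product)
  also have "\<dots> = (\<Sum>j<?m. \<Sum>i<j. ?l i * ?l j) - (\<Sum>j<?m. int j * ?l j)"
    by (simp only: inner) (simp add: sum_subtractf)
  finally have T: "(\<Sum>(i, j, k)\<in>{(i, j, k). i < j \<and> j < ?m \<and> 1 \<le> k \<and> k \<le> lam ! j}.
      ?l i + ?l j - 2 * int k) = (\<Sum>j<?m. \<Sum>i<j. ?l i * ?l j) - (\<Sum>j<?m. int j * ?l j)" .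
  have N: "(\<Sum>i<?m. ?l i) = int n + 1"
    using assms by (simp add: sum_list_sum_nth atLeast0LessThan flip: of_nat_sum)
  have "(int n + 1)\<^sup>2 = (\<Sum>i<?m. (?l i)\<^sup>2) + 2 * (\<Sum>j<?m. \<Sum>i<j. ?l i * ?l j)"
    unfolding N[symmetric] by (rule square_sum_lessThan)
  then show ?thesis
    unfolding T sum_subtractf N by (simp add: power2_eq_square algebra_simps)
qed

section \<open>Weights of rows\<close>

text \<open>The kernel of \<open>h\<close> is a subgroup, so it contains whatever \<open>X\<close>
  generates. The lemma serves twice, to carry a weight from the free group to P and from there to P
  / Q.\<close>

lemma (in comm_group) FactGroup_generate_universal:
  assumes "Group.group H" "h \<in> hom G H" "X \<subseteq> carrier G" "\<And>x. x \<in> X \<Longrightarrow> h x = \<one>\<^bsub>H\<^esub>"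
  shows "\<exists>g\<in>hom (G Mod generate G X) H. \<forall>x\<in>carrier G. g (generate G X #> x) = h x"
proof -
  interpret H: Group.group H by fact
  interpret h: group_hom G H h
    using assms(2) by unfold_locales
  have "generate G X \<subseteq> kernel G H h"
    using assms(3,4) by (intro generate_subgroup_incl h.subgroup_kernel) (auto simp: kernel_def)
  moreover have "generate G X \<lhd> G"
    using generate_is_subgroup[OF assms(3)] by (simp add: normal_iff_subgroup)
  ultimately show ?thesis using h.FactGroup_universal_kernel by metis
qed

abbreviation (input) "F_group n \<equiv> free_Abelian_group {1..n+1}"

lemma sum_generators_closed:
  "(\<Sum>j\<in>{1..n+1}. Poly_Mapping.single j (1 :: int)) \<in> carrier (F_group n)"
  using keys_sum[of "\<lambda>j. Poly_Mapping.single j (1 :: int)" "{1..n+1}"] by auto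

lemma comm_group_P_group: "comm_group (P_group n)"
proof -
  interpret F: comm_group "F_group n" by (rule abelian_free_Abelian_group)
  show ?thesis unfolding P_group_def sum_subgroup_def
    using sum_generators_closed by (intro F.abelian_FactGroup F.generate_is_subgroup) blast
qed

lemma P_gen_closed:
  assumes "j \<in> {1..n+1}"
  shows "P_gen n j \<in> carrier (P_group n)"
  using assms by (force simp: P_gen_def P_group_def FactGroup_def RCOSETS_def)

lemma Q_generators_closed:
  assumes "sum_list lam = n + 1"
  shows "{P_gen n j \<otimes>\<^bsub>P_group n\<^esub> inv\<^bsub>P_group n\<^esub> P_gen n k
       | i j k. i < length lam \<and> j \<in> row lam i \<and> k \<in> row lam i} \<subseteq> carrier (P_group n)"
proof -
  interpret P: comm_group "P_group n" by (rule comm_group_P_group)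
  have "P_gen n j \<in> carrier (P_group n)" if "j \<in> row lam i" for i j
    using that row_subset[of lam i] assms by (intro P_gen_closed) auto
  then show ?thesis by blast
qed

lemma comm_group_PQ_group:
  assumes "sum_list lam = n + 1"
  shows "comm_group (PQ_group n lam)"
proof -
  interpret P: comm_group "P_group n" by (rule comm_group_P_group)
  show ?thesis unfolding PQ_group_def Q_subgroup_def
    using Q_generators_closed[OF assms] by (intro P.abelian_FactGroup P.generate_is_subgroup)
qed

lemma first_in_row:
  assumes "partition_of N lam" "i < length lam"
  shows "Suc (sum_list (take i lam)) \<in> row lam i"
proof -
  have "0 < lam ! i" using assms nth_mem[OF assms(2)] unfolding partition_of_def by blast
  then show ?thesis using assms(2) by (simp add: row_def take_Suc_conv_app_nth)
qed

lemma e_row_closed: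
  assumes "partition_of (n + 1) lam" "i < length lam"
  shows "e_row n lam i \<in> carrier (PQ_group n lam)"
proof -
  have "Suc (sum_list (take i lam)) \<in> {1..n + 1}"
    using subsetD[OF row_subset first_in_row[OF assms]] assms(1) by (simp add: partition_of_def)
  then show ?thesis
    unfolding e_row_def PQ_group_def FactGroup_def RCOSETS_def partial_object.simps
    by (blast intro: P_gen_closed)
qed

text \<open>The weight of row \<open>i\<close>, scaled by \<open>n + 1\<close> and corrected by a multiple of the total weight so that it
  vanishes on the relation that defines \<open>P\<close>.\<close>

lemma row_weight_exists:
  assumes part: "partition_of (n + 1) lam" and i: "i < length lam"
  obtains \<psi> :: "pq \<Rightarrow> int" where "\<psi> \<in> hom (PQ_group n lam) integer_group"
    "\<And>k. k < length lam \<Longrightarrow> \<psi> (e_row n lam k) = (if k = i then int n + 1 else 0) - int (lam ! i)"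
proof -
  have N: "sum_list lam = n + 1" using part by (simp add: partition_of_def)
  interpret F: comm_group "F_group n" by (rule abelian_free_Abelian_group)
  interpret P: comm_group "P_group n" by (rule comm_group_P_group)
  define c where "c = (\<lambda>x. (if x \<in> row lam i then int n + 1 else 0) - int (lam ! i))"
  define h where "h = (\<lambda>f. \<Sum>x\<in>{1..n+1}. Poly_Mapping.lookup f x * c x)"
  have h_hom: "h \<in> hom (F_group n) integer_group"
    by (rule homI) (simp_all add: h_def lookup_add distrib_right sum.distrib)
  have h_single: "h (Poly_Mapping.single j 1) = c j" if "j \<in> {1..n+1}" for j
    using that by (simp add: h_def lookup_single when_def if_distrib[of "\<lambda>x. x * _"] sum.delta cong: if_cong)
  have card_row: "card (row lam i) = lam ! i"
    using i by (simp add: row_def take_Suc_conv_app_nth)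
  have "h (\<Sum>j\<in>{1..n+1}. Poly_Mapping.single j 1) = (\<Sum>x\<in>{1..n+1}. c x)"
  proof -
    have "h (\<Sum>j\<in>J. Poly_Mapping.single j 1) = (\<Sum>x\<in>J. c x)" if "J \<subseteq> {1..n+1}" for J
      using finite_subset[OF that finite_atLeastAtMost] that
    proof (induction J rule: finite_induct)
      case empty
      show ?case by (simp add: h_def)
    next
      case (insert j J)
      then show ?case using h_single[of j]
        by (simp add: h_def lookup_add distrib_right sum.distrib)
    qed
    then show ?thesis by blast
  qed
  also have "\<dots> = (\<Sum>x\<in>{1..n+1}. if x \<in> row lam i then int n + 1 else 0) - (int n + 1) * int (lam ! i)"
    by (simp add: c_def sum_subtractf)
  also have "(\<Sum>x\<in>{1..n+1}. if x \<in> row lam i then int n + 1 else 0) = (\<Sum>x\<in>row lam i. int n + 1)"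
    using row_subset[of lam i] N by (intro sum.mono_neutral_cong_right) auto
  also have "\<dots> = int (lam ! i) * (int n + 1)" by (simp add: card_row)
  finally have h_sum: "h (\<Sum>j\<in>{1..n+1}. Poly_Mapping.single j 1) = 0" by simp
  have sub: "{\<Sum>j\<in>{1..n+1}. Poly_Mapping.single j (1 :: int)} \<subseteq> carrier (F_group n)"
    using sum_generators_closed[of n] by blast
  have vanish: "h x = \<one>\<^bsub>integer_group\<^esub>" if "x \<in> {\<Sum>j\<in>{1..n+1}. Poly_Mapping.single j 1}" for x
    using that h_sum by (simp only: singleton_iff one_integer_group)
  obtain g where g: "g \<in> hom (P_group n) integer_group"
    and g_coset: "\<And>x. x \<in> carrier (F_group n) \<Longrightarrow> g (sum_subgroup n #>\<^bsub>F_group n\<^esub> x) = h x"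
    using F.FactGroup_generate_universal[OF group_integer_group h_hom sub vanish]
    unfolding P_group_def sum_subgroup_def by blast
  have g_gen: "g (P_gen n j) = c j" if "j \<in> {1..n+1}" for j
    using g_coset[of "Poly_Mapping.single j 1"] h_single[OF that] that by (simp add: P_gen_def)
  interpret g: group_hom "P_group n" integer_group g
    using g by (intro group_hom.intro group_hom_axioms.intro P.group_axioms group_integer_group)
  have g_rel: "g x = \<one>\<^bsub>integer_group\<^esub>"
    if "x \<in> {P_gen n j \<otimes>\<^bsub>P_group n\<^esub> inv\<^bsub>P_group n\<^esub> P_gen n k
       | i j k. i < length lam \<and> j \<in> row lam i \<and> k \<in> row lam i}" for x
  proof -
    from that obtain r j k where x: "x = P_gen n j \<otimes>\<^bsub>P_group n\<^esub> inv\<^bsub>P_group n\<^esub> P_gen n k"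
      and jk: "j \<in> row lam r" "k \<in> row lam r" by blast
    have mem: "j \<in> {1..n+1}" "k \<in> {1..n+1}"
      using subsetD[OF row_subset jk(1)] subsetD[OF row_subset jk(2)] N by auto
    \<comment> \<open>The function \<open>c\<close> depends only on membership in row
      \<open>i\<close>. Rows are disjoint, so it is constant on each of them and the generators of
      \<open>Q_subgroup\<close> are sent to 0.\<close>
    have "c j = c k" using jk rows_disjoint[of j lam r i] rows_disjoint[of k lam r i] by (auto simp: c_def)
    then show ?thesis using mem by (simp add: x P_gen_closed g_gen)
  qed
  obtain \<psi> where psi: "\<psi> \<in> hom (PQ_group n lam) integer_group"
    and psi_coset: "\<And>x. x \<in> carrier (P_group n) \<Longrightarrow> \<psi> (Q_subgroup n lam #>\<^bsub>P_group n\<^esub> x) = g x"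
    using P.FactGroup_generate_universal[OF group_integer_group g Q_generators_closed[OF N] g_rel]
    unfolding PQ_group_def Q_subgroup_def by blast
  show thesis
  proof (rule that[OF psi])
    fix k assume k: "k < length lam"
    let ?x = "Suc (sum_list (take k lam))"
    have x: "?x \<in> row lam k" using part k by (rule first_in_row)
    then have "?x \<in> {1..n+1}" using subsetD[OF row_subset x] N by auto
    then have "\<psi> (e_row n lam k) = c ?x"
      unfolding e_row_def using psi_coset[OF P_gen_closed] g_gen by simp
    then show "\<psi> (e_row n lam k) = (if k = i then int n + 1 else 0) - int (lam ! i)"
      using x rows_disjoint[of ?x lam k i] by (auto simp: c_def)
  qed
qed

text \<open>The correction by \<open>lam ! i\<close> is the same for all rows and cancels in a
  difference.\<close>

lemma row_weight_difference:
  assumes part: "partition_of (n + 1) lam" and i: "i < length lam"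
  obtains \<psi> :: "pq \<Rightarrow> int" where
    "\<And>x y. x \<in> carrier (PQ_group n lam) \<Longrightarrow> y \<in> carrier (PQ_group n lam) \<Longrightarrow>
      \<psi> (x \<otimes>\<^bsub>PQ_group n lam\<^esub> y) = \<psi> x + \<psi> y"
    "\<And>k l. k < length lam \<Longrightarrow> l < length lam \<Longrightarrow>
      \<psi> (e_row n lam k \<otimes>\<^bsub>PQ_group n lam\<^esub> inv\<^bsub>PQ_group n lam\<^esub> e_row n lam l)
      = (int n + 1) * (of_bool (k = i) - of_bool (l = i))"
proof -
  interpret PQ: comm_group "PQ_group n lam"
    using part by (intro comm_group_PQ_group) (simp add: partition_of_def)
  obtain \<psi> :: "pq \<Rightarrow> int" where psi: "\<psi> \<in> hom (PQ_group n lam) integer_group"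
    "\<And>k. k < length lam \<Longrightarrow> \<psi> (e_row n lam k) = (if k = i then int n + 1 else 0) - int (lam ! i)"
    using row_weight_exists[OF assms] by metis
  interpret psi: group_hom "PQ_group n lam" integer_group \<psi>
    using psi(1) by (intro group_hom.intro group_hom_axioms.intro PQ.group_axioms group_integer_group)
  show thesis
    by (rule that[of \<psi>]) (simp_all add: psi(2) e_row_closed[OF part])
qed

text \<open>Up to the factor n + 1, the weights of a difference are 1 at its first row, -1 at its
  second and 0 at the others, which recovers both rows. This lets a product over the set
  \<open>Phi_G\<close> be written over pairs of rows.\<close>

lemma e_row_difference_inj:
  assumes part: "partition_of (n + 1) lam"
  shows "inj_on (\<lambda>(i, j). e_row n lam i \<otimes>\<^bsub>PQ_group n lam\<^esub> inv\<^bsub>PQ_group n lam\<^esub> e_row n lam j)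
    {(i, j). i < length lam \<and> j < length lam \<and> i \<noteq> j}"
proof (rule inj_onI, clarsimp)
  fix i j k l
  assume *: "i < length lam" "j < length lam" "i \<noteq> j" "k < length lam" "l < length lam" "k \<noteq> l"
    and eq: "e_row n lam i \<otimes>\<^bsub>PQ_group n lam\<^esub> inv\<^bsub>PQ_group n lam\<^esub> e_row n lam j
      = e_row n lam k \<otimes>\<^bsub>PQ_group n lam\<^esub> inv\<^bsub>PQ_group n lam\<^esub> e_row n lam l"
  have "of_bool (i = m) - of_bool (j = m) = (of_bool (k = m) - of_bool (l = m) :: int)"
    if "m < length lam" for m
  proof -
    obtain \<psi> :: "pq \<Rightarrow> int" where psi: "\<And>k l. k < length lam \<Longrightarrow> l < length lam \<Longrightarrow>
      \<psi> (e_row n lam k \<otimes>\<^bsub>PQ_group n lam\<^esub> inv\<^bsub>PQ_group n lam\<^esub> e_row n lam l)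
      = (int n + 1) * (of_bool (k = m) - of_bool (l = m))"
      using row_weight_difference[OF part \<open>m < length lam\<close>] by metis
    have "(int n + 1) * (of_bool (i = m) - of_bool (j = m)) = (int n + 1) * (of_bool (k = m) - of_bool (l = m))"
      using psi[of i j] psi[of k l] eq * by metis
    moreover have "int n + 1 \<noteq> 0" by simp
    ultimately show ?thesis by (metis mult_left_cancel)
  qed
  from this[of i] this[of j] show "i = k \<and> j = l"
    using * by (auto simp: of_bool_def split: if_splits)
qed

section \<open>The leading term of the quotient\<close>

lemma (in cring) regular_finprod:
  assumes "\<And>i. i \<in> A \<Longrightarrow> f i \<in> regular_elems R"
  shows "finprod R f A \<in> regular_elems R"
  using assms
proof (induction A rule: infinite_finite_induct)
  case (insert i A)
  then have "f \<in> A \<rightarrow> carrier R" "f i \<in> carrier R" by (auto simp: regular_elems_def)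
  then show ?case using insert by (simp add: regular_mult)
qed (simp_all add: regular_one)

lemma (in cring) regular_nonzero:
  assumes "s \<in> regular_elems R" "\<one> \<noteq> \<zero>"
  shows "s \<noteq> \<zero>"
  using assms unfolding regular_elems_def by auto

text \<open>Since the embedding is injective, the series is unique; this is what evaluates the
  \<open>THE\<close> in \<open>expansion\<close>.\<close>

lemma (in cring) frac_leadE:
  assumes "frac_lead y d a"
  obtains F where "F \<in> carrier L" "emb F = y" "laurent_lead F d a"
    "(THE F. F \<in> carrier L \<and> emb F = y) = F"
proof -
  obtain F where F: "laurent_lead F d a" "emb F = y" using assms by (auto simp: frac_lead_def)
  moreover have car: "F \<in> carrier L" using F by (simp add: laurent_lead_def)
  moreover have "(THE F. F \<in> carrier L \<and> emb F = y) = F"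
    using F(2) car cring.frac_embed_inject[OF cring_laurent_ring] by (intro the_equality) auto
  ultimately show thesis using that by blast
qed

text \<open>\<open>laurent_lead\<close> by itself only bounds the degree; a nonzero coefficient
  makes the bound sharp.\<close>

lemma laurent_deg_eq:
  assumes "cring R" "cring.laurent_lead R F d a" "a \<noteq> \<zero>\<^bsub>R\<^esub>"
  shows "laurent_deg R F = d"
  unfolding laurent_deg_def
proof (rule Greatest_equality)
  show "F d \<noteq> \<zero>\<^bsub>R\<^esub>" using assms(2,3) by (simp add: cring.laurent_lead_def[OF assms(1)])
  show "k \<le> d" if "F k \<noteq> \<zero>\<^bsub>R\<^esub>" for k
    using that assms(2) by (auto simp: cring.laurent_lead_def[OF assms(1)] not_less[symmetric])
qed

text \<open>Although the group ring may have zero divisors, \<open>p\<close> cannot vanish: each of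
  its factors is regular, so \<open>p\<close> is regular in a ring with 1 different from 0.\<close>

lemma frac_lead_C_quotient_zeta:
  assumes part: "partition_of (n + 1) lam"
  defines "p \<equiv> (\<Otimes>\<^bsub>zeta_ring n lam\<^esub>\<alpha>\<in>Phi_G n lam. \<one>\<^bsub>zeta_ring n lam\<^esub> \<ominus>\<^bsub>zeta_ring n lam\<^esub> zeta \<alpha>)"
  shows "cring.frac_lead (zeta_ring n lam) (C_quotient n lam) (- 2 * int (length_w_conj lam)) p"
    and "p \<noteq> \<zero>\<^bsub>zeta_ring n lam\<^esub>"
proof -
  let ?P = "PQ_group n lam" and ?Z = "zeta_ring n lam" and ?e = "e_row n lam"
  have N: "sum_list lam = n + 1" and sorted: "sorted_wrt (\<ge>) lam" and pos: "\<forall>x\<in>set lam. 0 < x"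
    using part by (simp_all add: partition_of_def)
  have comm: "comm_group ?P" using N by (rule comm_group_PQ_group)
  interpret P: comm_group ?P by (rule comm)
  interpret R: cring ?Z unfolding zeta_ring_def using comm by (rule cring_group_ring)
  define w where "w = (\<lambda>i. zeta (?e i))"
  define D where "D = {(i, j). i < length lam \<and> j < length lam \<and> i \<noteq> j \<and> lam ! i = lam ! j}"
  define \<delta> where "\<delta> = (\<lambda>(i, j). ?e i \<otimes>\<^bsub>?P\<^esub> inv\<^bsub>?P\<^esub> ?e j)"
  have w: "w i \<in> Units ?Z" "inv\<^bsub>?Z\<^esub> (w i) = zeta (inv\<^bsub>?P\<^esub> ?e i)" if "i < length lam" for i
    using Units_group_ring[OF comm e_row_closed[OF part that]]
    by (simp_all add: w_def zeta_def zeta_ring_def)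
  have diff: "w i \<otimes>\<^bsub>?Z\<^esub> inv\<^bsub>?Z\<^esub> (w j) = zeta (\<delta> (i, j))"
    if "i < length lam" "j < length lam" for i j
    using w(2)[OF that(2)]
    by (simp add: w_def zeta_def zeta_ring_def \<delta>_def group_ring_mult_frag_of)
  have \<delta>_closed: "\<delta> (i, j) \<in> carrier ?P" if "i < length lam" "j < length lam" for i j
    using e_row_closed[OF part] that by (simp add: \<delta>_def)
  have zeta_closed: "zeta x \<in> carrier ?Z" if "x \<in> carrier ?P" for x
    using that by (simp add: zeta_def zeta_ring_def group_ring_simps)
  have reg_\<delta>: "\<one>\<^bsub>?Z\<^esub> \<ominus>\<^bsub>?Z\<^esub> zeta (\<delta> (i, j)) \<in> regular_elems ?Z"
    if ij: "i < length lam" "j < length lam" "i \<noteq> j" for i j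
  proof -
    \<comment> \<open>The weight of row \<open>i\<close> takes the value n + 1 on the difference of
      rows \<open>i\<close> and \<open>j\<close>, since these rows are distinct.\<close>
    obtain \<psi> :: "pq \<Rightarrow> int" where "\<And>x y. x \<in> carrier ?P \<Longrightarrow> y \<in> carrier ?P \<Longrightarrow>
      \<psi> (x \<otimes>\<^bsub>?P\<^esub> y) = \<psi> x + \<psi> y" and "\<And>k l. k < length lam \<Longrightarrow> l < length lam \<Longrightarrow>
      \<psi> (?e k \<otimes>\<^bsub>?P\<^esub> inv\<^bsub>?P\<^esub> ?e l) = (int n + 1) * (of_bool (k = i) - of_bool (l = i))"
      by (rule row_weight_difference[OF part ij(1)]) blast
    then show ?thesis
      unfolding zeta_def zeta_ring_def using ij
      by (intro regular_one_minus_frag_of[OF comm \<delta>_closed, where \<psi> = \<psi>]) (auto simp: \<delta>_def)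
  qed
  have reg: "\<one>\<^bsub>?Z\<^esub> \<ominus>\<^bsub>?Z\<^esub> inv\<^bsub>?Z\<^esub> (w i) \<otimes>\<^bsub>?Z\<^esub> w j \<in> regular_elems ?Z"
    if "i < length lam" "j < length lam" "i \<noteq> j" for i j
  proof -
    have "inv\<^bsub>?Z\<^esub> (w i) \<otimes>\<^bsub>?Z\<^esub> w j = zeta (\<delta> (j, i))"
      using diff[OF that(2,1)] w(1)[OF that(1)] w(1)[OF that(2)] by (simp add: R.m_comm R.Units_closed)
    then show ?thesis using reg_\<delta>[of j i] that by simp
  qed
  have Phi: "Phi_G n lam = \<delta> ` D"
    unfolding Phi_G_def \<delta>_def D_def by force
  have inj: "inj_on \<delta> D"
    unfolding \<delta>_def D_def by (rule inj_on_subset[OF e_row_difference_inj[OF part]]) auto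
  have "p = (\<Otimes>\<^bsub>?Z\<^esub>t\<in>D. \<one>\<^bsub>?Z\<^esub> \<ominus>\<^bsub>?Z\<^esub> zeta (\<delta> t))"
    unfolding p_def Phi using \<delta>_closed zeta_closed inj by (intro R.finprod_reindex) (auto simp: D_def)
  also have "\<dots> = finprod ?Z (\<lambda>(i, j). \<one>\<^bsub>?Z\<^esub> \<ominus>\<^bsub>?Z\<^esub> w i \<otimes>\<^bsub>?Z\<^esub> inv\<^bsub>?Z\<^esub> (w j)) D"
    using \<delta>_closed zeta_closed diff by (intro R.finprod_cong') (auto simp: D_def)
  finally have p: "p = finprod ?Z (\<lambda>(i, j). \<one>\<^bsub>?Z\<^esub> \<ominus>\<^bsub>?Z\<^esub> w i \<otimes>\<^bsub>?Z\<^esub> inv\<^bsub>?Z\<^esub> (w j)) D" .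
  have sorted': "lam ! j \<le> lam ! i" if "i < j" "j < length lam" for i j
    using that sorted by (simp add: sorted_wrt_iff_nth_less)
  have deg: "- 2 * (\<Sum>i<length lam. int i * int (lam ! i)) = - 2 * int (length_w_conj lam)"
    by (simp add: length_w_conj_eq[OF sorted])
  show "R.frac_lead (C_quotient n lam) (- 2 * int (length_w_conj lam)) p"
    unfolding p deg[symmetric] C_quotient_degree[OF N, symmetric] D_def w_def
      C_quotient_def Let_def frac_ring_def q_elem_def v_elem_def z_elem_def series_ring_def
    using pos sorted' w(1)[unfolded w_def] reg[unfolded w_def] by (rule R.frac_lead_C_quotient)
  have "p \<in> regular_elems ?Z"
    unfolding p_def Phi by (intro R.regular_finprod) (use reg_\<delta> in \<open>auto simp: D_def\<close>)
  moreover have "\<one>\<^bsub>?Z\<^esub> \<noteq> \<zero>\<^bsub>?Z\<^esub>" by (simp add: zeta_ring_def group_ring_simps)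
  ultimately show "p \<noteq> \<zero>\<^bsub>?Z\<^esub>" by (rule R.regular_nonzero)
qed

text \<open>The existence of a nonzero series equal to the quotient is stated because
  \<open>expansion\<close> and \<open>laurent_deg\<close>, defined by \<open>THE\<close> and
  \<open>GREATEST\<close>, are meaningful only then.\<close>

theorem proposition5p8:
  fixes n :: nat and lam :: "nat list"
  assumes "n \<ge> 1" and "partition_of (n + 1) lam"
  shows "(\<exists>F\<in>carrier (series_ring n lam). F \<noteq> \<zero>\<^bsub>series_ring n lam\<^esub> \<and>
            frac_embed (series_ring n lam) F = C_quotient n lam) \<and>
         laurent_deg (zeta_ring n lam) (expansion n lam (C_quotient n lam))
           = - 2 * int (length_w_conj lam) \<and>
         sp0 (expansion n lam
            (q_elem n lam [^]\<^bsub>frac_ring n lam\<^esub> (2 * int (length_w_conj lam))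
               \<otimes>\<^bsub>frac_ring n lam\<^esub> C_quotient n lam))
           = (\<Otimes>\<^bsub>zeta_ring n lam\<^esub>\<alpha>\<in>Phi_G n lam. \<one>\<^bsub>zeta_ring n lam\<^esub> \<ominus>\<^bsub>zeta_ring n lam\<^esub> zeta \<alpha>)"
proof -
  let ?Z = "zeta_ring n lam" and ?d = "2 * int (length_w_conj lam)"
  let ?p = "\<Otimes>\<^bsub>zeta_ring n lam\<^esub>\<alpha>\<in>Phi_G n lam. \<one>\<^bsub>zeta_ring n lam\<^esub> \<ominus>\<^bsub>zeta_ring n lam\<^esub> zeta \<alpha>"
  have "sum_list lam = n + 1" using assms(2) by (simp add: partition_of_def)
  then have cring: "cring ?Z"
    unfolding zeta_ring_def by (intro cring_group_ring comm_group_PQ_group)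
  interpret R: cring ?Z by (rule cring)
  note lead = frac_lead_C_quotient_zeta[OF assms(2)]
  obtain F where F: "F \<in> carrier (series_ring n lam)"
    "frac_embed (series_ring n lam) F = C_quotient n lam"
    "R.laurent_lead F (- 2 * int (length_w_conj lam)) ?p"
    "expansion n lam (C_quotient n lam) = F"
    unfolding expansion_def series_ring_def using lead(1) by (rule R.frac_leadE) blast
  have nz: "F \<noteq> \<zero>\<^bsub>series_ring n lam\<^esub>"
    using F(3) lead(2) by (auto simp: R.laurent_lead_def series_ring_def laurent_ring_simps)
  have deg: "laurent_deg ?Z (expansion n lam (C_quotient n lam)) = - 2 * int (length_w_conj lam)"
    unfolding F(4) using laurent_deg_eq[OF cring F(3) lead(2)] by simp
  have "q_elem n lam [^]\<^bsub>frac_ring n lam\<^esub> ?d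
      = frac_embed (series_ring n lam) (laurent_monom ?Z \<one>\<^bsub>?Z\<^esub> ?d)"
    using R.emb_monom_int_pow[of "\<one>\<^bsub>?Z\<^esub>" 1 ?d]
    by (simp add: q_elem_def frac_ring_def series_ring_def laurent_q_eq_monom)
  then have "R.frac_lead (q_elem n lam [^]\<^bsub>frac_ring n lam\<^esub> ?d) ?d \<one>\<^bsub>?Z\<^esub>"
    using R.frac_lead_monom[OF R.one_closed, of ?d] by (simp add: series_ring_def)
  \<comment> \<open>The power of q moves the leading exponent to 0. No positive power of q remains,
    and the coefficient that \<open>sp0\<close> reads off is \<open>?p\<close>.\<close>
  from R.frac_lead_mult[OF this lead(1)] R.frac_lead_closed(2)[OF lead(1)]
  have "R.frac_lead (q_elem n lam [^]\<^bsub>frac_ring n lam\<^esub> ?d \<otimes>\<^bsub>frac_ring n lam\<^esub> C_quotient n lam) 0 ?p"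
    by (simp add: frac_ring_def series_ring_def)
  then obtain G where "R.laurent_lead G 0 ?p"
    "expansion n lam (q_elem n lam [^]\<^bsub>frac_ring n lam\<^esub> ?d \<otimes>\<^bsub>frac_ring n lam\<^esub> C_quotient n lam) = G"
    unfolding expansion_def series_ring_def by (rule R.frac_leadE) blast
  then have "sp0 (expansion n lam
      (q_elem n lam [^]\<^bsub>frac_ring n lam\<^esub> ?d \<otimes>\<^bsub>frac_ring n lam\<^esub> C_quotient n lam)) = ?p"
    by (simp add: sp0_def R.laurent_lead_def)
  with F(1,2) nz deg show ?thesis by blast
qed

end
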